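(* Let $G=\mathbb{Z}\times\mathbb{Z}$, let $G^+$ be a positive cone of $G$, and let $S=G^+$. (1) If $G^+$ induces a total archimedean order on $G$, then $\operatorname{card}\Delta_S>1$. (2) If $G^+$ induces a lexicographical-product order on $G$, then $\operatorname{card}\Delta_S=1$.
   Context: A positive cone $G^+$ of an additive abelian group $G$ is a subsemigroup with $G=G^+\cup(-G^+)$ and $G^+\cap(-G^+)=\{0\}$; it induces the total order $a\preceq b$ iff $b-a\in G^+$. The order is archimedean if for all $a,b\in G^+\setminus\{0\}$ there is a positive integer $n$ with $b\preceq na$. A total order on $\mathbb{Z}\times\mathbb{Z}$ is a lexicographical-product order if its positive cone is the image, under some group automorphism of $\mathbb{Z}\times\mathbb{Z}$, of $$\{(n,m)\in\mathbb{Z}\times\mathbb{Z} : m>0\}\cup\{(n,0): n\ge 0\}$$ (these are the orders determined by a line through the origin containing nonzero integer points). An isometric representation of $S$ is a semigroup homomorphism $a\mapsto V_a$ from $S$ into the isometries on a Hilbert space (so $V_{a+b}=V_aV_b$, $V_0=I$). It is faithful if $a\mapsto V_a$ is injective, non-unitary if $V_a$ is not unitary for every $a\in S$, $a\ne0$, and irreducible if the family $\{V_a,V_a^*:a\in S\}$ has no nontrivial closed invariant subspace. $\Delta_S$ denotes the set of unitary equivalence classes of faithful irreducible non-unitary isometric representations of $S$. *)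

theory Defs
  imports "HOL-Analysis.Analysis" "HOL-Algebra.Algebraic_Closure_Type"
    "HOL-Library.Product_Plus"
begin

section \<open>Ordered groups\<close>

definition positive_cone :: "'g::ab_group_add set \<Rightarrow> bool" where
  "positive_cone P \<longleftrightarrow>
     (\<forall>a\<in>P. \<forall>b\<in>P. a + b \<in> P) \<and> P \<union> uminus ` P = UNIV \<and> P \<inter> uminus ` P = {0}"

definition cone_le :: "'g::ab_group_add set \<Rightarrow> 'g \<Rightarrow> 'g \<Rightarrow> bool" where
  "cone_le P a b \<longleftrightarrow> b - a \<in> P"

text \<open>The sum of \<open>n\<close> copies of \<open>a\<close> is the multiple \<open>n a\<close>.\<close>

definition archimedean_cone :: "'g::ab_group_add set \<Rightarrow> bool" where
  "archimedean_cone P \<longleftrightarrow>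
     (\<forall>a\<in>P - {0}. \<forall>b\<in>P - {0}. \<exists>n::nat. n > 0 \<and> cone_le P b (\<Sum>i<n. a))"

definition lex_cone :: "(int \<times> int) set" where
  "lex_cone = {(n, m). m > 0} \<union> {(n, 0) |n. n \<ge> 0}"

definition lexicographic_cone :: "(int \<times> int) set \<Rightarrow> bool" where
  "lexicographic_cone P \<longleftrightarrow> (\<exists>f. Modules.additive f \<and> bij f \<and> P = f ` lex_cone)"


section \<open>Hilbert spaces with an explicit carrier\<close>

text \<open>
  The Hilbert space is not fixed in advance: different representations act on different
  spaces. Hence a Hilbert space is a record whose carrier is a subset of a type.
  The fields \<open>mult\<close> and \<open>one\<close>, inherited from the ring record underlying modules,
  carry no information.
\<close>

abbreviation complex_field :: "complex ring" where
  "complex_field \<equiv> ring_of_type_algebra"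

record 'a hilbert = "(complex, 'a) module" +
  ip :: "'a \<Rightarrow> 'a \<Rightarrow> complex"

definition hnorm :: "'a hilbert \<Rightarrow> 'a \<Rightarrow> real" where
  "hnorm H x = sqrt (Re (ip H x x))"

text \<open>The value 0 off the carrier is needed because the locale \<open>Metric_space\<close>
  requires symmetry and nonnegativity on the whole type.\<close>

definition hdist :: "'a hilbert \<Rightarrow> 'a \<Rightarrow> 'a \<Rightarrow> real" where
  "hdist H x y = (if x \<in> carrier H \<and> y \<in> carrier H then hnorm H (x \<ominus>\<^bsub>H\<^esub> y) else 0)"

text \<open>The inner product is linear in the first argument.\<close>

definition hilbert_space :: "'a hilbert \<Rightarrow> bool" where
  "hilbert_space H \<longleftrightarrow>
     module complex_field H \<and>
     (\<forall>x\<in>carrier H. \<forall>y\<in>carrier H. \<forall>z\<in>carrier H.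
        ip H (x \<oplus>\<^bsub>H\<^esub> y) z = ip H x z + ip H y z) \<and>
     (\<forall>c. \<forall>x\<in>carrier H. \<forall>y\<in>carrier H. ip H (c \<odot>\<^bsub>H\<^esub> x) y = c * ip H x y) \<and>
     (\<forall>x\<in>carrier H. \<forall>y\<in>carrier H. ip H y x = cnj (ip H x y)) \<and>
     (\<forall>x\<in>carrier H. 0 \<le> Re (ip H x x)) \<and>
     (\<forall>x\<in>carrier H. ip H x x = 0 \<longrightarrow> x = \<zero>\<^bsub>H\<^esub>) \<and>
     Metric_space.mcomplete (carrier H) (hdist H)"

definition closed_subspace :: "'a hilbert \<Rightarrow> 'a set \<Rightarrow> bool" where
  "closed_subspace H M \<longleftrightarrow>
     submodule M complex_field H \<and>
     closedin (Metric_space.mtopology (carrier H) (hdist H)) M"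

definition hlinear :: "'a hilbert \<Rightarrow> 'b hilbert \<Rightarrow> ('a \<Rightarrow> 'b) \<Rightarrow> bool" where
  "hlinear H K T \<longleftrightarrow>
     T \<in> carrier H \<rightarrow> carrier K \<and>
     (\<forall>x\<in>carrier H. \<forall>y\<in>carrier H. T (x \<oplus>\<^bsub>H\<^esub> y) = T x \<oplus>\<^bsub>K\<^esub> T y) \<and>
     (\<forall>c. \<forall>x\<in>carrier H. T (c \<odot>\<^bsub>H\<^esub> x) = c \<odot>\<^bsub>K\<^esub> T x)"

definition isometry :: "'a hilbert \<Rightarrow> 'b hilbert \<Rightarrow> ('a \<Rightarrow> 'b) \<Rightarrow> bool" where
  "isometry H K T \<longleftrightarrow> hlinear H K T \<and> (\<forall>x\<in>carrier H. hnorm K (T x) = hnorm H x)"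

definition unitary :: "'a hilbert \<Rightarrow> 'b hilbert \<Rightarrow> ('a \<Rightarrow> 'b) \<Rightarrow> bool" where
  "unitary H K T \<longleftrightarrow> isometry H K T \<and> T ` carrier H = carrier K"

text \<open>For a bounded operator \<open>T\<close> on a Hilbert space the description determines the value
  uniquely (Riesz).\<close>

definition hadjoint :: "'a hilbert \<Rightarrow> ('a \<Rightarrow> 'a) \<Rightarrow> 'a \<Rightarrow> 'a" where
  "hadjoint H T y = (THE z. z \<in> carrier H \<and> (\<forall>x\<in>carrier H. ip H (T x) y = ip H x z))"


section \<open>Isometric representations\<close>

text \<open>A representation is a pair of a Hilbert space \<open>H\<close> and a family \<open>V\<close>. Only the values
  \<open>V a x\<close> with \<open>a \<in> S\<close> and \<open>x \<in> carrier H\<close> matter.\<close>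

type_synonym ('g, 'a) rep = "'a hilbert \<times> ('g \<Rightarrow> 'a \<Rightarrow> 'a)"

definition isometric_rep :: "'g::ab_group_add set \<Rightarrow> ('g, 'a) rep \<Rightarrow> bool" where
  "isometric_rep S = (\<lambda>(H, V).
     hilbert_space H \<and>
     (\<forall>a\<in>S. isometry H H (V a)) \<and>
     (\<forall>x\<in>carrier H. V 0 x = x) \<and>
     (\<forall>a\<in>S. \<forall>b\<in>S. \<forall>x\<in>carrier H. V (a + b) x = V a (V b x)))"

definition faithful_rep :: "'g::ab_group_add set \<Rightarrow> ('g, 'a) rep \<Rightarrow> bool" where
  "faithful_rep S = (\<lambda>(H, V). inj_on (\<lambda>a. restrict (V a) (carrier H)) S)"

definition nonunitary_rep :: "'g::ab_group_add set \<Rightarrow> ('g, 'a) rep \<Rightarrow> bool" where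
  "nonunitary_rep S = (\<lambda>(H, V). \<forall>a\<in>S - {0}. \<not> unitary H H (V a))"

definition irreducible_rep :: "'g::ab_group_add set \<Rightarrow> ('g, 'a) rep \<Rightarrow> bool" where
  "irreducible_rep S = (\<lambda>(H, V).
     \<forall>M. closed_subspace H M \<and>
         (\<forall>a\<in>S. V a ` M \<subseteq> M \<and> hadjoint H (V a) ` M \<subseteq> M) \<longrightarrow>
         M = {\<zero>\<^bsub>H\<^esub>} \<or> M = carrier H)"

definition unitarily_equivalent ::
    "'g::ab_group_add set \<Rightarrow> ('g, 'a) rep \<Rightarrow> ('g, 'b) rep \<Rightarrow> bool" where
  "unitarily_equivalent S = (\<lambda>(H, V) (K, W).
     \<exists>U. unitary H K U \<and> (\<forall>a\<in>S. \<forall>x\<in>carrier H. U (V a x) = W a (U x)))"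

definition admissible_reps :: "'g::ab_group_add set \<Rightarrow> ('g, 'a) rep set" where
  "admissible_reps S =
     {r. isometric_rep S r \<and> faithful_rep S r \<and> irreducible_rep S r \<and> nonunitary_rep S r}"

text \<open>The type \<open>'a\<close> is the universe from which the carriers are taken. An irreducible
  representation of a countable semigroup acts on a separable space, which has an isometric copy
  with carrier in \<open>'a\<close> as soon as the square-summable sequences embed into \<open>'a\<close>.
  For such \<open>'a\<close> no unitary equivalence class is lost.\<close>

definition Delta :: "'a itself \<Rightarrow> 'g::ab_group_add set \<Rightarrow> ('g, 'a) rep set set" where
  "Delta _ S = admissible_reps S //
     {(r, s). r \<in> admissible_reps S \<and> s \<in> admissible_reps S \<and> unitarily_equivalent S r s}"

end

theory Submission
  imports Defs
begin

text \<open>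
  Let \<open>A\<close> be a set with \<open>P + A \<subseteq> A\<close>. Then \<open>P\<close> acts by translations on the square-summable functions
  on \<open>A\<close>. Here \<open>V\<^sub>a V\<^sub>a\<^sup>*\<close> restricts functions to \<open>a + A\<close>. If differences of such sets separate every
  point of \<open>A\<close> from any finite set of other points, the representation is irreducible
  (\<open>irreducible_translation\<close>): an invariant subspace that contains a function not vanishing at \<open>b\<close>
  contains \<open>\<delta>\<^sub>b\<close> as a limit of restrictions of this function, and hence all unit vectors. Both
  \<open>A = P\<close> and \<open>A = P - {0}\<close> have this property for every total order on a nontrivial group
  (\<open>full_admissible\<close>, \<open>punctured_admissible\<close>).

  On \<open>P\<close> the vector \<open>\<delta>\<^sub>0\<close> is orthogonal to the range of each \<open>V\<^sub>a\<close> with \<open>a \<noteq> 0\<close>. An archimedean order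
  on \<open>\<int> \<times> \<int>\<close> has no least positive element, since that element would generate the group. So every
  positive element is a sum of two positive elements (\<open>archimedean_cone_dense\<close>), and on \<open>P - {0}\<close>
  only the zero vector is orthogonal to all these ranges. The two representations are therefore not
  equivalent (\<open>full_punctured_inequivalent\<close>), which gives two classes.

  A lexicographic order has a least positive element \<open>e\<close>, and the ranges of all \<open>V\<^sub>a\<close> with \<open>a \<noteq> 0\<close>
  lie in the range of \<open>V\<^sub>e\<close>. In a nonunitary representation some unit vector \<open>\<xi>\<close> is orthogonal to
  this range (\<open>wandering_vector_exists\<close>). Its orbit \<open>V\<^sub>b \<xi>\<close> is orthonormal, and the orthogonal
  complement of the orbit is invariant under all \<open>V\<^sub>a\<close> and \<open>V\<^sub>a\<^sup>*\<close>, so in an irreducible representation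
  the orbit is an orthonormal basis. Taking coefficients identifies the representation with the
  translations on \<open>P\<close> (\<open>equivalent_to_translation\<close>), which leaves exactly one class. That every
  square-summable function is a coefficient function follows from the Riesz representation theorem
  in place of a summation of series of vectors.
\<close>

section \<open>Inner products on a carrier\<close>

lemma complex_field_simps [simp]:
  "carrier complex_field = UNIV"
  "add complex_field = (+)"
  "monoid.mult complex_field = (*)"
  "one complex_field = 1"
  "ring.zero complex_field = 0"
  by (simp_all add: ring_of_type_algebra_def)

locale inner_product_module = module complex_field H
  for H :: "'a hilbert" (structure) +
  assumes ip_add_left:
      "\<lbrakk>x \<in> carrier H; y \<in> carrier H; z \<in> carrier H\<rbrakk> \<Longrightarrow> ip H (x \<oplus> y) z = ip H x z + ip H y z"
    and ip_smult_left: "\<lbrakk>x \<in> carrier H; y \<in> carrier H\<rbrakk> \<Longrightarrow> ip H (c \<odot> x) y = c * ip H x y"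
    and ip_commute: "\<lbrakk>x \<in> carrier H; y \<in> carrier H\<rbrakk> \<Longrightarrow> ip H y x = cnj (ip H x y)"
    and ip_self_nonneg: "x \<in> carrier H \<Longrightarrow> 0 \<le> Re (ip H x x)"
    and ip_self_eq_0: "\<lbrakk>x \<in> carrier H; ip H x x = 0\<rbrakk> \<Longrightarrow> x = \<zero>"
begin

lemma ip_add_right:
  "\<lbrakk>x \<in> carrier H; y \<in> carrier H; z \<in> carrier H\<rbrakk> \<Longrightarrow> ip H z (x \<oplus> y) = ip H z x + ip H z y"
  by (metis M.a_closed complex_cnj_add ip_add_left ip_commute)

lemma smult_mem [simp]: "x \<in> carrier H \<Longrightarrow> c \<odot> x \<in> carrier H"
  by simp

lemma ip_smult_right:
  "\<lbrakk>x \<in> carrier H; y \<in> carrier H\<rbrakk> \<Longrightarrow> ip H y (c \<odot> x) = cnj c * ip H y x"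
  by (metis smult_mem complex_cnj_mult ip_smult_left ip_commute)

lemma ip_zero_left [simp]: "x \<in> carrier H \<Longrightarrow> ip H \<zero> x = 0"
  using ip_add_left[of \<zero> \<zero> x] by simp

lemma ip_zero_right [simp]: "x \<in> carrier H \<Longrightarrow> ip H x \<zero> = 0"
  using ip_add_right[of \<zero> \<zero> x] by simp

lemma ip_uminus_left: "\<lbrakk>x \<in> carrier H; z \<in> carrier H\<rbrakk> \<Longrightarrow> ip H (\<ominus> x) z = - ip H x z"
  using ip_add_left[of x "\<ominus> x" z] by (simp add: M.r_neg add_eq_0_iff)

lemma ip_diff_left:
  "\<lbrakk>x \<in> carrier H; y \<in> carrier H; z \<in> carrier H\<rbrakk> \<Longrightarrow> ip H (x \<ominus> y) z = ip H x z - ip H y z"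
  by (simp add: a_minus_def ip_add_left ip_uminus_left)

lemma ip_diff_right:
  "\<lbrakk>x \<in> carrier H; y \<in> carrier H; z \<in> carrier H\<rbrakk> \<Longrightarrow> ip H z (x \<ominus> y) = ip H z x - ip H z y"
  by (metis M.minus_closed complex_cnj_diff ip_diff_left ip_commute)

lemmas ip_simps = ip_add_left ip_add_right ip_smult_left ip_smult_right ip_diff_left ip_diff_right

lemma ip_self: "x \<in> carrier H \<Longrightarrow> ip H x x = of_real ((hnorm H x)\<^sup>2)"
proof -
  assume x: "x \<in> carrier H"
  have "Im (ip H x x) = 0"
    using ip_commute[OF x x] by (metis cnj.simps(2) equal_neg_zero)
  then show ?thesis
    using ip_self_nonneg[OF x] by (simp add: hnorm_def complex_eq_iff)
qed

lemma hnorm_nonneg [simp]: "x \<in> carrier H \<Longrightarrow> 0 \<le> hnorm H x"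
  by (simp add: hnorm_def ip_self_nonneg)

lemma hnorm_square: "x \<in> carrier H \<Longrightarrow> (hnorm H x)\<^sup>2 = Re (ip H x x)"
  by (simp add: hnorm_def ip_self_nonneg)

lemma hnorm_zero [simp]: "hnorm H \<zero> = 0"
  by (simp add: hnorm_def)

lemma hnorm_eq_0_iff [simp]: "x \<in> carrier H \<Longrightarrow> hnorm H x = 0 \<longleftrightarrow> x = \<zero>"
  using ip_self ip_self_eq_0 by fastforce

lemma diff_eq_0_iff: "\<lbrakk>x \<in> carrier H; y \<in> carrier H\<rbrakk> \<Longrightarrow> x \<ominus> y = \<zero> \<longleftrightarrow> x = y"
  using M.minus_equality[of x "\<ominus> y"] by (auto simp: a_minus_def M.r_neg)

text \<open>Identities between vectors are checked by pairing both sides with every vector, which turns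
  them into identities between complex numbers.\<close>

lemma vector_eqI:
  assumes "x \<in> carrier H" "y \<in> carrier H" "\<And>z. z \<in> carrier H \<Longrightarrow> ip H x z = ip H y z"
  shows "x = y"
proof -
  have "ip H (x \<ominus> y) (x \<ominus> y) = 0"
    using assms by (simp add: ip_diff_left)
  then have "x \<ominus> y = \<zero>"
    using assms ip_self_eq_0 M.minus_closed by blast
  then show ?thesis
    using assms(1,2) by (simp add: diff_eq_0_iff)
qed

lemma vector_eqI_right:
  assumes "x \<in> carrier H" "y \<in> carrier H" "\<And>z. z \<in> carrier H \<Longrightarrow> ip H z x = ip H z y"
  shows "x = y"
  using assms by (metis ip_commute vector_eqI)

lemma hnorm_smult: "x \<in> carrier H \<Longrightarrow> hnorm H (c \<odot> x) = cmod c * hnorm H x"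
proof -
  assume x: "x \<in> carrier H"
  have "ip H (c \<odot> x) (c \<odot> x) = of_real ((cmod c)\<^sup>2 * (hnorm H x)\<^sup>2)"
    using x complex_norm_square[of c] by (simp add: ip_simps ip_self[OF x] mult.assoc[symmetric])
  then have "(hnorm H (c \<odot> x))\<^sup>2 = (cmod c * hnorm H x)\<^sup>2"
    using x by (simp add: hnorm_square power_mult_distrib)
  then show ?thesis
    using x by (simp add: power2_eq_iff_nonneg)
qed

lemma hnorm_add_square:
  "\<lbrakk>x \<in> carrier H; y \<in> carrier H\<rbrakk> \<Longrightarrow>
   (hnorm H (x \<oplus> y))\<^sup>2 = (hnorm H x)\<^sup>2 + (hnorm H y)\<^sup>2 + 2 * Re (ip H x y)"
  by (subst (1 2 3) hnorm_square) (auto simp: ip_simps ip_commute[of x y])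

lemma hnorm_diff_square:
  "\<lbrakk>x \<in> carrier H; y \<in> carrier H\<rbrakk> \<Longrightarrow>
   (hnorm H (x \<ominus> y))\<^sup>2 = (hnorm H x)\<^sup>2 + (hnorm H y)\<^sup>2 - 2 * Re (ip H x y)"
  by (subst (1 2 3) hnorm_square) (auto simp: ip_simps ip_commute[of x y])

lemma Cauchy_Schwarz:
  assumes x: "x \<in> carrier H" and y: "y \<in> carrier H"
  shows "cmod (ip H x y) \<le> hnorm H x * hnorm H y"
proof (cases "hnorm H y = 0")
  case True
  then show ?thesis using x y by simp
next
  case False
  define c where "c = ip H x y / of_real ((hnorm H y)\<^sup>2)"
  \<comment> \<open>Subtracting from \<open>x\<close> its projection onto \<open>y\<close> leaves a vector of nonnegative square norm.\<close>
  have "0 \<le> (hnorm H (x \<ominus> c \<odot> y))\<^sup>2" by simp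
  also have "\<dots> = (hnorm H x)\<^sup>2 + (cmod c * hnorm H y)\<^sup>2 - 2 * Re (cnj c * ip H x y)"
    using x y by (simp add: hnorm_diff_square hnorm_smult ip_smult_right)
  also have "cnj c * ip H x y = of_real ((cmod (ip H x y))\<^sup>2 / (hnorm H y)\<^sup>2)"
    using complex_norm_square[of "ip H x y"] by (simp add: c_def mult.commute)
  also have "cmod c * hnorm H y = cmod (ip H x y) / hnorm H y"
    using False y by (simp add: c_def norm_divide norm_mult power2_eq_square)
  finally have "(cmod (ip H x y))\<^sup>2 \<le> (hnorm H x * hnorm H y)\<^sup>2"
    using False by (simp add: power_divide power_mult_distrib divide_le_eq)
  then show ?thesis
    by (rule power2_le_imp_le) (use x y in simp)
qed

lemma hnorm_triangle:
  assumes x: "x \<in> carrier H" and y: "y \<in> carrier H"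
  shows "hnorm H (x \<oplus> y) \<le> hnorm H x + hnorm H y"
proof (rule power2_le_imp_le)
  have "Re (ip H x y) \<le> hnorm H x * hnorm H y"
    using Cauchy_Schwarz[OF x y] complex_Re_le_cmod order_trans by blast
  then show "(hnorm H (x \<oplus> y))\<^sup>2 \<le> (hnorm H x + hnorm H y)\<^sup>2"
    using x y by (simp add: hnorm_add_square power2_sum)
qed (use x y in simp)

lemma hnorm_diff_commute:
  "\<lbrakk>x \<in> carrier H; y \<in> carrier H\<rbrakk> \<Longrightarrow> hnorm H (x \<ominus> y) = hnorm H (y \<ominus> x)"
  by (simp add: hnorm_def ip_simps)

lemma diff_add_diff:
  "\<lbrakk>x \<in> carrier H; y \<in> carrier H; z \<in> carrier H\<rbrakk> \<Longrightarrow> (x \<ominus> y) \<oplus> (y \<ominus> z) = x \<ominus> z"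
  by (rule vector_eqI) (simp_all add: ip_simps)

lemma Metric_space_hdist: "Metric_space (carrier H) (hdist H)"
proof
  fix x y z
  show "0 \<le> hdist H x y" by (simp add: hdist_def)
  show "hdist H x y = hdist H y x" by (simp add: hdist_def hnorm_diff_commute)
  assume "x \<in> carrier H" "y \<in> carrier H"
  then show "hdist H x y = 0 \<longleftrightarrow> x = y"
    by (simp add: hdist_def diff_eq_0_iff)
  assume "z \<in> carrier H"
  with \<open>x \<in> carrier H\<close> \<open>y \<in> carrier H\<close> show "hdist H x z \<le> hdist H x y + hdist H y z"
    using hnorm_triangle[of "x \<ominus> y" "y \<ominus> z"] by (simp add: hdist_def diff_add_diff)
qed

sublocale metric: Metric_space "carrier H" "hdist H"
  by (rule Metric_space_hdist)

lemma closed_subspace_limit: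
  assumes "closed_subspace H M" "z \<in> carrier H"
    and "\<And>r. r > 0 \<Longrightarrow> \<exists>y\<in>M. hnorm H (z \<ominus> y) < r"
  shows "z \<in> M"
proof (rule ccontr)
  assume "z \<notin> M"
  with assms(1,2) obtain r where r: "r > 0" "disjnt M (metric.mball z r)" and M: "M \<subseteq> carrier H"
    unfolding closed_subspace_def metric.closedin_metric by blast
  with assms(3) obtain y where "y \<in> M" "hnorm H (z \<ominus> y) < r" by blast
  with M assms(2) have "y \<in> metric.mball z r"
    by (auto simp: hdist_def)
  with \<open>y \<in> M\<close> r(2) show False
    by (auto simp: disjnt_iff)
qed

lemma annihilator_closed_subspace:
  assumes A: "A \<subseteq> carrier H"
  shows "closed_subspace H {y \<in> carrier H. \<forall>u\<in>A. ip H y u = 0}" (is "closed_subspace H ?M")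
  unfolding closed_subspace_def metric.closedin_metric
proof (intro conjI allI impI)
  show "submodule ?M complex_field H"
    by (rule submoduleI) (use A in \<open>auto simp: ip_simps ip_uminus_left subset_iff\<close>)
  show "?M \<subseteq> carrier H" by blast
  fix x assume "x \<in> carrier H - ?M"
  then obtain u where x: "x \<in> carrier H" and u: "u \<in> A" "ip H x u \<noteq> 0" by blast
  with A have uH: "u \<in> carrier H" by blast
  have "u \<noteq> \<zero>" using u x by auto
  then have un: "hnorm H u > 0"
    using hnorm_nonneg[OF uH] hnorm_eq_0_iff[OF uH] by linarith
  have "disjnt ?M (metric.mball x (cmod (ip H x u) / hnorm H u))"
  proof (clarsimp simp: disjnt_iff hdist_def x)
    fix y assume y: "y \<in> carrier H" "\<forall>u\<in>A. ip H y u = 0"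
      and less: "hnorm H (x \<ominus> y) < cmod (ip H x u) / hnorm H u"
    have "cmod (ip H x u) = cmod (ip H (x \<ominus> y) u)"
      using x y u uH by (simp add: ip_simps)
    also have "\<dots> \<le> hnorm H (x \<ominus> y) * hnorm H u"
      using x y uH by (intro Cauchy_Schwarz) auto
    finally show False
      using less un by (simp add: field_simps)
  qed
  then show "\<exists>r>0. disjnt ?M (metric.mball x r)"
    using u un by (meson divide_pos_pos zero_less_norm_iff)
qed

end

lemma isometry_ip:
  assumes "inner_product_module H" "inner_product_module K" "isometry H K T"
    and x: "x \<in> carrier H" and y: "y \<in> carrier H"
  shows "ip K (T x) (T y) = ip H x y"
proof -
  interpret H: inner_product_module H by fact
  interpret K: inner_product_module K by fact
  have T: "T x \<in> carrier K" "T (x \<oplus>\<^bsub>H\<^esub> y) = T x \<oplus>\<^bsub>K\<^esub> T y" "T (c \<odot>\<^bsub>H\<^esub> x) = c \<odot>\<^bsub>K\<^esub> T x"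
      "hnorm K (T x) = hnorm H x" if "x \<in> carrier H" "y \<in> carrier H" for x y c
    using assms(3) that by (auto simp: isometry_def hlinear_def)
  have Re: "Re (ip K (T x) (T y)) = Re (ip H x y)" if "x \<in> carrier H" "y \<in> carrier H" for x y
    using H.hnorm_add_square[OF that] K.hnorm_add_square[of "T x" "T y"]
      T(1,4)[OF that] T(1,4)[OF that(2,1)] T(2)[OF that] T(4)[of "x \<oplus>\<^bsub>H\<^esub> y"] that
    by simp
  \<comment> \<open>The real part of \<open>i\<langle>x, y\<rangle>\<close> is minus the imaginary part of \<open>\<langle>x, y\<rangle>\<close>.\<close>
  have "Re (ip K (\<i> \<odot>\<^bsub>K\<^esub> T x) (T y)) = Re (ip H (\<i> \<odot>\<^bsub>H\<^esub> x) y)"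
    using Re[of "\<i> \<odot>\<^bsub>H\<^esub> x" y] T(3)[OF x y] x y by simp
  then show ?thesis
    using Re[OF x y] x y T(1)[OF x y] T(1)[OF y x]
    by (simp add: H.ip_smult_left K.ip_smult_left complex_eq_iff)
qed

section \<open>Riesz representation and adjoints\<close>

locale complex_hilbert = inner_product_module +
  assumes complete: "Metric_space.mcomplete (carrier H) (hdist H)"

lemma hilbert_space_iff: "hilbert_space H \<longleftrightarrow> complex_hilbert H"
  unfolding hilbert_space_def complex_hilbert_def complex_hilbert_axioms_def
    inner_product_module_def inner_product_module_axioms_def by blast

context complex_hilbert
begin

lemma Cauchy_limit:
  assumes mem: "\<And>n. x n \<in> carrier H"
    and Cauchy: "\<And>\<epsilon>. \<epsilon> > 0 \<Longrightarrow> \<exists>N. \<forall>m\<ge>N. \<forall>n\<ge>N. hnorm H (x m \<ominus> x n) < \<epsilon>"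
  obtains z where "z \<in> carrier H" "(\<lambda>n. hnorm H (x n \<ominus> z)) \<longlonglongrightarrow> 0"
proof -
  have "metric.MCauchy x"
    unfolding metric.MCauchy_def using mem Cauchy by (fastforce simp: hdist_def)
  with complete obtain z where z: "limitin metric.mtopology x z sequentially"
    unfolding metric.mcomplete_def by blast
  then have "z \<in> carrier H" "(\<lambda>n. hnorm H (x n \<ominus> z)) \<longlonglongrightarrow> 0"
    using mem by (auto simp: metric.limitin_metric_dist_null hdist_def)
  then show thesis by (rule that)
qed

text \<open>The Riesz vector of \<open>\<phi>\<close> is the minimiser of \<open>J x = \<parallel>x\<parallel>\<^sup>2 - 2 Re (\<phi> x)\<close>. By the parallelogram
  law every minimising sequence is Cauchy, and the vanishing of the directional derivatives of \<open>J\<close>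
  at the limit is the representation of \<open>\<phi>\<close>.\<close>

lemma Riesz_representation:
  assumes add: "\<And>x y. \<lbrakk>x \<in> carrier H; y \<in> carrier H\<rbrakk> \<Longrightarrow> \<phi> (x \<oplus> y) = \<phi> x + \<phi> y"
    and scale: "\<And>c x. x \<in> carrier H \<Longrightarrow> \<phi> (c \<odot> x) = c * \<phi> x"
    and bound: "\<And>x. x \<in> carrier H \<Longrightarrow> cmod (\<phi> x) \<le> C * hnorm H x"
  obtains z where "z \<in> carrier H" "\<And>x. x \<in> carrier H \<Longrightarrow> \<phi> x = ip H x z"
proof -
  define J where "J x = (hnorm H x)\<^sup>2 - 2 * Re (\<phi> x)" for x
  have J_lower: "- C\<^sup>2 \<le> J x" if "x \<in> carrier H" for x
  proof -
    have "Re (\<phi> x) \<le> C * hnorm H x"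
      using bound[OF that] complex_Re_le_cmod order_trans by blast
    then have "(hnorm H x - C)\<^sup>2 \<le> J x + C\<^sup>2"
      by (simp add: J_def power2_diff mult.commute)
    then show ?thesis
      using zero_le_power2[of "hnorm H x - C"] by linarith
  qed
  define d where "d = Inf (J ` carrier H)"
  have bdd: "bdd_below (J ` carrier H)"
    using J_lower by (auto simp: bdd_below_def)
  have d_le: "d \<le> J x" if "x \<in> carrier H" for x
    unfolding d_def using bdd that by (auto intro: cInf_lower)
  have "\<exists>x\<in>carrier H. J x < d + inverse (real (Suc n))" for n
  proof -
    have "d < d + inverse (real (Suc n))" by simp
    then show ?thesis
      unfolding d_def using bdd by (subst (asm) cInf_less_iff) (auto intro: M.zero_closed)
  qed
  then obtain x where x: "\<And>n. x n \<in> carrier H" and J_x: "\<And>n. J (x n) < d + inverse (real (Suc n))"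
    by metis
  have \<phi>_diff: "\<phi> (u \<ominus> v) = \<phi> u - \<phi> v" if "u \<in> carrier H" "v \<in> carrier H" for u v
  proof -
    have "\<phi> ((u \<ominus> v) \<oplus> v) = \<phi> u"
      using that by (intro arg_cong[of _ _ \<phi>] vector_eqI) (auto simp: ip_simps)
    then show ?thesis
      using that add[of "u \<ominus> v" v] by (simp add: eq_diff_eq)
  qed
  have near: "(hnorm H (u \<ominus> v))\<^sup>2 \<le> 2 * (J u - d) + 2 * (J v - d)"
    if uv: "u \<in> carrier H" "v \<in> carrier H" for u v
  proof -
    have half: "(1/2) \<odot> (u \<oplus> v) \<in> carrier H"
      using uv by simp
    have "4 * J ((1/2) \<odot> (u \<oplus> v)) = (hnorm H (u \<oplus> v))\<^sup>2 - 4 * Re (\<phi> u) - 4 * Re (\<phi> v)"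
      using uv by (simp add: J_def hnorm_smult scale add power_divide)
    then show ?thesis
      using d_le[OF half] uv by (simp add: J_def hnorm_add_square hnorm_diff_square)
  qed
  have "\<exists>N. \<forall>m\<ge>N. \<forall>n\<ge>N. hnorm H (x m \<ominus> x n) < \<epsilon>" if "\<epsilon> > 0" for \<epsilon>
  proof -
    obtain N where N: "inverse (real (Suc N)) < \<epsilon>\<^sup>2 / 4"
      using reals_Archimedean[of "\<epsilon>\<^sup>2 / 4"] \<open>\<epsilon> > 0\<close> by auto
    have "hnorm H (x m \<ominus> x n) < \<epsilon>" if mn: "m \<ge> N" "n \<ge> N" for m n
    proof (rule power2_less_imp_less)
      have J_near: "J (x k) - d < \<epsilon>\<^sup>2 / 4" if "k \<ge> N" for k
      proof -
        have "inverse (real (Suc k)) \<le> inverse (real (Suc N))"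
          using that by (auto intro: le_imp_inverse_le)
        with N have "inverse (real (Suc k)) < \<epsilon>\<^sup>2 / 4" by (rule order_le_less_trans[rotated])
        with J_x[of k] show ?thesis by linarith
      qed
      show "(hnorm H (x m \<ominus> x n))\<^sup>2 < \<epsilon>\<^sup>2"
        using near[OF x x, of m n] J_near[OF mn(1)] J_near[OF mn(2)] by argo
    qed (use \<open>\<epsilon> > 0\<close> in simp)
    then show ?thesis by blast
  qed
  from Cauchy_limit[OF x this] obtain z where z: "z \<in> carrier H"
    and lim: "(\<lambda>n. hnorm H (x n \<ominus> z)) \<longlonglongrightarrow> 0" by blast
  have "(\<lambda>n. \<phi> (x n \<ominus> z)) \<longlonglongrightarrow> 0"
    by (rule Lim_null_comparison[where g = "\<lambda>n. C * hnorm H (x n \<ominus> z)"])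
       (use bound x z lim in \<open>auto intro!: always_eventually tendsto_mult_right_zero\<close>)
  then have \<phi>_lim: "(\<lambda>n. \<phi> (x n)) \<longlonglongrightarrow> \<phi> z"
    using x z by (simp add: \<phi>_diff LIM_zero_iff)
  have "(\<lambda>n. ip H (x n \<ominus> z) z) \<longlonglongrightarrow> 0"
    by (rule Lim_null_comparison[where g = "\<lambda>n. hnorm H (x n \<ominus> z) * hnorm H z"])
       (use Cauchy_Schwarz x z lim in \<open>auto intro!: always_eventually tendsto_mult_left_zero\<close>)
  then have ip_lim: "(\<lambda>n. ip H (x n) z) \<longlonglongrightarrow> ip H z z"
    using x z by (simp add: ip_simps LIM_zero_iff)
  have "(\<lambda>n. (hnorm H (x n \<ominus> z))\<^sup>2 - (hnorm H z)\<^sup>2 + 2 * Re (ip H (x n) z) - 2 * Re (\<phi> (x n)))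
      \<longlonglongrightarrow> 0\<^sup>2 - (hnorm H z)\<^sup>2 + 2 * Re (ip H z z) - 2 * Re (\<phi> z)"
    by (intro tendsto_intros lim ip_lim \<phi>_lim)
  then have "(\<lambda>n. J (x n)) \<longlonglongrightarrow> J z"
    using x z by (simp add: hnorm_diff_square J_def hnorm_square[symmetric])
  moreover have "(\<lambda>n. d + inverse (real (Suc n))) \<longlonglongrightarrow> d + 0"
    by (intro tendsto_intros LIMSEQ_inverse_real_of_nat)
  ultimately have "J z \<le> d"
    using J_x by (intro LIMSEQ_le[of "\<lambda>n. J (x n)" _ "\<lambda>n. d + inverse (real (Suc n))"])
      (auto intro: less_imp_le)
  then have J_min: "J z \<le> J y" if "y \<in> carrier H" for y
    using d_le[OF that] by linarith
  have Re_eq: "Re (\<phi> h) = Re (ip H h z)" if h: "h \<in> carrier H" for h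
  proof -
    define b where "b = Re (ip H h z) - Re (\<phi> h)"
    have quad: "0 \<le> t\<^sup>2 * (hnorm H h)\<^sup>2 + 2 * t * b" for t :: real
    proof -
      have "Re (ip H z h) = Re (ip H h z)"
        using ip_commute[OF h z] by simp
      then have "J (z \<oplus> of_real t \<odot> h) = J z + (t\<^sup>2 * (hnorm H h)\<^sup>2 + 2 * t * b)"
        using h z by (simp add: J_def hnorm_add_square hnorm_smult add scale ip_smult_right b_def
            power_mult_distrib algebra_simps)
      then show ?thesis
        using J_min[of "z \<oplus> of_real t \<odot> h"] h z by simp
    qed
    have "b = 0"
    proof (rule ccontr)
      assume "b \<noteq> 0"
      define A where "A = (hnorm H h)\<^sup>2 + 1"
      have "A > 0" by (simp add: A_def add_nonneg_pos)
      \<comment> \<open>\<open>t = - b / A\<close> minimises the quadratic \<open>A t\<^sup>2 + 2 b t\<close>. The summand 1 in \<open>A\<close> covers the case \<open>h = \<zero>\<close>.\<close>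
      have "0 \<le> (- b / A)\<^sup>2 * (A - 1) + 2 * (- b / A) * b"
        using quad[of "- b / A"] by (simp add: A_def)
      also have "\<dots> = - b\<^sup>2 / A - (b / A)\<^sup>2"
        using \<open>A > 0\<close> by (simp add: field_simps power2_eq_square)
      finally have "b\<^sup>2 / A + (b / A)\<^sup>2 \<le> 0" by simp
      moreover have "b\<^sup>2 / A > 0" using \<open>A > 0\<close> \<open>b \<noteq> 0\<close> by simp
      ultimately show False using zero_le_power2[of "b / A"] by linarith
    qed
    then show ?thesis by (simp add: b_def)
  qed
  have "\<phi> h = ip H h z" if h: "h \<in> carrier H" for h
    using Re_eq[OF h] Re_eq[of "\<i> \<odot> h"] h z by (simp add: scale ip_smult_left complex_eq_iff)
  with z show thesis by (rule that)
qed

lemma hadjoint_eqI: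
  assumes "z \<in> carrier H" and "V \<in> carrier H \<rightarrow> carrier H"
    and "\<And>x. x \<in> carrier H \<Longrightarrow> ip H (V x) y = ip H x z"
  shows "hadjoint H V y = z"
  unfolding hadjoint_def
  by (rule the_equality) (use assms in \<open>auto intro!: vector_eqI_right\<close>)

text \<open>Since \<open>V\<close> is isometric, \<open>x \<mapsto> \<langle>V x, y\<rangle>\<close> is a bounded functional. Its Riesz vector is the value
  singled out by the definite description of the adjoint.\<close>

lemma hadjoint:
  assumes V: "isometry H H V" and y: "y \<in> carrier H"
  shows hadjoint_mem: "hadjoint H V y \<in> carrier H"
    and ip_hadjoint: "x \<in> carrier H \<Longrightarrow> ip H (V x) y = ip H x (hadjoint H V y)"
proof -
  have V_mem: "V \<in> carrier H \<rightarrow> carrier H" using V by (simp add: isometry_def hlinear_def)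
  obtain z where z: "z \<in> carrier H" "\<And>x. x \<in> carrier H \<Longrightarrow> ip H (V x) y = ip H x z"
  proof (rule Riesz_representation[of "\<lambda>x. ip H (V x) y" "hnorm H y"])
    fix x assume "x \<in> carrier H"
    then show "cmod (ip H (V x) y) \<le> hnorm H y * hnorm H x"
      using V y Cauchy_Schwarz[of "V x" y]
      by (auto simp: isometry_def hlinear_def mult.commute)
  qed (use V y in \<open>auto simp: isometry_def hlinear_def ip_simps Pi_iff\<close>)
  with V_mem have "hadjoint H V y = z" by (intro hadjoint_eqI) auto
  with z show "hadjoint H V y \<in> carrier H"
    "x \<in> carrier H \<Longrightarrow> ip H (V x) y = ip H x (hadjoint H V y)" by auto
qed

end

section \<open>Square-summable functions\<close>

definition ell2 :: "'i set \<Rightarrow> ('i \<Rightarrow> complex) set" where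
  "ell2 A = {f. (\<forall>i. i \<notin> A \<longrightarrow> f i = 0) \<and> (\<lambda>i. (cmod (f i))\<^sup>2) summable_on UNIV}"

definition ell2_ip :: "('i \<Rightarrow> complex) \<Rightarrow> ('i \<Rightarrow> complex) \<Rightarrow> complex" where
  "ell2_ip f g = (\<Sum>\<^sub>\<infinity>i. f i * cnj (g i))"

definition delta :: "'i \<Rightarrow> 'i \<Rightarrow> complex" where
  "delta b i = (if i = b then 1 else 0)"

text \<open>The Hilbert space of square-summable functions on \<open>A\<close>, moved into the universe by an injection
  \<open>j\<close>. Functions on a set are represented by their extension by zero.\<close>

definition l2_space :: "(('i \<Rightarrow> complex) \<Rightarrow> 'u) \<Rightarrow> 'i set \<Rightarrow> 'u hilbert" where
  "l2_space j A =
     \<lparr>carrier = j ` ell2 A, monoid.mult = (\<lambda>x y. x), one = j (\<lambda>_. 0), ring.zero = j (\<lambda>_. 0),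
      add = (\<lambda>x y. j (\<lambda>i. inv_into UNIV j x i + inv_into UNIV j y i)),
      smult = (\<lambda>c x. j (\<lambda>i. c * inv_into UNIV j x i)),
      ip = (\<lambda>x y. ell2_ip (inv_into UNIV j x) (inv_into UNIV j y))\<rparr>"

lemma ell2_off: "f \<in> ell2 A \<Longrightarrow> i \<notin> A \<Longrightarrow> f i = 0"
  by (simp add: ell2_def)

lemma ell2_summable: "f \<in> ell2 A \<Longrightarrow> (\<lambda>i. (cmod (f i))\<^sup>2) summable_on UNIV"
  by (simp add: ell2_def)

lemma ell2_dominated:
  assumes f: "f \<in> ell2 Y" and g: "\<And>i. cmod (g i) \<le> cmod (f i)" "\<And>i. i \<notin> A \<Longrightarrow> g i = 0"
  shows "g \<in> ell2 A"
proof -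
  have "(\<lambda>i. (cmod (g i))\<^sup>2) summable_on UNIV"
    by (rule summable_on_comparison_test[OF ell2_summable[OF f]])
       (use g in \<open>auto intro: power_mono\<close>)
  with g show ?thesis by (simp add: ell2_def)
qed

lemma ell2_finite_support:
  assumes "finite F" "F \<subseteq> A" "\<And>i. i \<notin> F \<Longrightarrow> f i = 0"
  shows "f \<in> ell2 A"
proof -
  have "{i. (cmod (f i))\<^sup>2 \<noteq> 0} \<subseteq> F" using assms(3) by auto
  with assms(1) have "(\<lambda>i. (cmod (f i))\<^sup>2) summable_on UNIV"
    by (intro finite_nonzero_values_imp_summable_on) (auto intro: finite_subset)
  with assms(2,3) show ?thesis by (auto simp: ell2_def)
qed

lemma ell2_bounded_sums:
  assumes "\<And>i. i \<notin> A \<Longrightarrow> f i = 0" "\<And>F. finite F \<Longrightarrow> (\<Sum>i\<in>F. (cmod (f i))\<^sup>2) \<le> C"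
  shows "f \<in> ell2 A" "(\<Sum>\<^sub>\<infinity>i. (cmod (f i))\<^sup>2) \<le> C"
proof -
  have s: "(\<lambda>i. (cmod (f i))\<^sup>2) summable_on UNIV"
    by (rule nonneg_bounded_partial_sums_imp_summable_on[where C = C])
       (use assms(2) in \<open>auto simp: eventually_finite_subsets_at_top\<close>)
  with assms(1) show "f \<in> ell2 A" by (simp add: ell2_def)
  show "(\<Sum>\<^sub>\<infinity>i. (cmod (f i))\<^sup>2) \<le> C"
    using s assms(2) by (intro infsum_le_finite_sums)
qed

lemma delta_ell2: "b \<in> A \<Longrightarrow> delta b \<in> ell2 A"
  by (rule ell2_finite_support[of "{b}"]) (auto simp: delta_def)

lemma zero_ell2: "(\<lambda>_. 0) \<in> ell2 A"
  by (simp add: ell2_def)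

lemma ell2_scale: "f \<in> ell2 A \<Longrightarrow> (\<lambda>i. c * f i) \<in> ell2 A"
  by (simp add: ell2_def norm_mult power_mult_distrib summable_on_cmult_right)

lemma ell2_add:
  assumes f: "f \<in> ell2 A" and g: "g \<in> ell2 A"
  shows "(\<lambda>i. f i + g i) \<in> ell2 A"
proof -
  have "(cmod (f i + g i))\<^sup>2 \<le> 2 * (cmod (f i))\<^sup>2 + 2 * (cmod (g i))\<^sup>2" for i
  proof -
    have "(cmod (f i + g i))\<^sup>2 \<le> (cmod (f i) + cmod (g i))\<^sup>2"
      by (intro power_mono norm_triangle_ineq) simp
    also have "\<dots> \<le> 2 * (cmod (f i))\<^sup>2 + 2 * (cmod (g i))\<^sup>2"
      using zero_le_power2[of "cmod (f i) - cmod (g i)"] by (simp add: power2_sum power2_diff)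
    finally show ?thesis .
  qed
  moreover have "(\<lambda>i. 2 * (cmod (f i))\<^sup>2 + 2 * (cmod (g i))\<^sup>2) summable_on UNIV"
    using f g by (intro summable_on_add summable_on_cmult_right ell2_summable)
  ultimately have "(\<lambda>i. (cmod (f i + g i))\<^sup>2) summable_on UNIV"
    by (intro summable_on_comparison_test[where g = "\<lambda>i. (cmod (f i + g i))\<^sup>2"]) auto
  with f g show ?thesis by (simp add: ell2_def)
qed

lemma ell2_diff: "f \<in> ell2 A \<Longrightarrow> g \<in> ell2 A \<Longrightarrow> (\<lambda>i. f i - g i) \<in> ell2 A"
  using ell2_add[OF _ ell2_scale[of g A "-1"]] by simp

lemma ell2_prod_summable:
  assumes "f \<in> ell2 A" "g \<in> ell2 A"
  shows "(\<lambda>i. f i * cnj (g i)) summable_on UNIV"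
proof -
  have "(\<lambda>i. norm (f i * cnj (g i))) summable_on UNIV"
    by (rule abs_summable_product) (use assms in \<open>auto simp: norm_mult power2_eq_square ell2_def\<close>)
  then show ?thesis by (rule abs_summable_summable)
qed

lemma ell2_ip_self:
  assumes "f \<in> ell2 A"
  shows "ell2_ip f f = of_real (\<Sum>\<^sub>\<infinity>i. (cmod (f i))\<^sup>2)"
proof -
  have "((\<lambda>i. (cmod (f i))\<^sup>2) has_sum (\<Sum>\<^sub>\<infinity>i. (cmod (f i))\<^sup>2)) UNIV"
    using assms by (simp add: ell2_summable)
  then have "((\<lambda>i. of_real ((cmod (f i))\<^sup>2)) has_sum complex_of_real (\<Sum>\<^sub>\<infinity>i. (cmod (f i))\<^sup>2)) UNIV"
    by (rule has_sum_of_real)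
  then have "(\<Sum>\<^sub>\<infinity>i. complex_of_real ((cmod (f i))\<^sup>2)) = complex_of_real (\<Sum>\<^sub>\<infinity>i. (cmod (f i))\<^sup>2)"
    by (rule infsumI)
  then show ?thesis
    by (simp only: ell2_ip_def complex_norm_square)
qed

lemma ell2_ip_delta: "ell2_ip f (delta b) = f b"
proof -
  have "ell2_ip f (delta b) = (\<Sum>\<^sub>\<infinity>i\<in>{b}. f i)"
    unfolding ell2_ip_def by (rule infsum_cong_neutral) (auto simp: delta_def)
  then show ?thesis by simp
qed

lemma ell2_sum_le:
  "f \<in> ell2 A \<Longrightarrow> finite F \<Longrightarrow> (\<Sum>i\<in>F. (cmod (f i))\<^sup>2) \<le> (\<Sum>\<^sub>\<infinity>i. (cmod (f i))\<^sup>2)"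
  by (rule finite_sum_le_infsum) (auto simp: ell2_summable)

locale l2_model =
  fixes j :: "('i \<Rightarrow> complex) \<Rightarrow> 'u"
  assumes inj: "inj j"
begin

lemma inv_j [simp]: "inv_into UNIV j (j f) = f"
  using inj by simp

lemma l2_space_simps [simp]:
  "carrier (l2_space j A) = j ` ell2 A"
  "\<zero>\<^bsub>l2_space j A\<^esub> = j (\<lambda>_. 0)"
  "j f \<oplus>\<^bsub>l2_space j A\<^esub> j g = j (\<lambda>i. f i + g i)"
  "c \<odot>\<^bsub>l2_space j A\<^esub> j f = j (\<lambda>i. c * f i)"
  "ip (l2_space j A) (j f) (j g) = ell2_ip f g"
  by (simp_all add: l2_space_def)

lemma j_mem_iff [simp]: "j f \<in> j ` A \<longleftrightarrow> f \<in> A"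
  using inj by (simp add: inj_image_mem_iff)

lemma j_eq_iff [simp]: "j f = j g \<longleftrightarrow> f = g"
  using inj by (simp add: inj_eq)

lemma module_l2_space: "module complex_field (l2_space j A)"
proof (rule moduleI)
  show "cring complex_field" by (rule cring_from_type_algebra)
  show "abelian_group (l2_space j A)"
  proof (rule abelian_groupI)
    fix x assume "x \<in> carrier (l2_space j A)"
    then obtain f where f: "x = j f" "f \<in> ell2 A" by auto
    then have "j (\<lambda>i. -1 * f i) \<in> carrier (l2_space j A)"
      using ell2_scale[of f A "-1"] by simp
    moreover have "j (\<lambda>i. -1 * f i) \<oplus>\<^bsub>l2_space j A\<^esub> x = \<zero>\<^bsub>l2_space j A\<^esub>"
      using f by simp
    ultimately show "\<exists>y\<in>carrier (l2_space j A). y \<oplus>\<^bsub>l2_space j A\<^esub> x = \<zero>\<^bsub>l2_space j A\<^esub>" ..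
  qed (auto simp: ell2_add zero_ell2 algebra_simps)
qed (auto simp: ell2_scale algebra_simps)

lemma inner_product_module_l2_space: "inner_product_module (l2_space j A)"
proof -
  interpret module complex_field "l2_space j A" by (rule module_l2_space)
  show ?thesis
  proof
    fix x y z assume "x \<in> carrier (l2_space j A)" "y \<in> carrier (l2_space j A)" "z \<in> carrier (l2_space j A)"
    then show "ip (l2_space j A) (x \<oplus>\<^bsub>l2_space j A\<^esub> y) z = ip (l2_space j A) x z + ip (l2_space j A) y z"
      by (auto simp: ell2_ip_def algebra_simps intro!: infsum_add ell2_prod_summable)
  next
    fix x y c assume "x \<in> carrier (l2_space j A)" "y \<in> carrier (l2_space j A)"
    then show "ip (l2_space j A) (c \<odot>\<^bsub>l2_space j A\<^esub> x) y = c * ip (l2_space j A) x y"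
      by (auto simp: ell2_ip_def mult.assoc infsum_cmult_right')
  next
    fix x y assume "x \<in> carrier (l2_space j A)" "y \<in> carrier (l2_space j A)"
    then show "ip (l2_space j A) y x = cnj (ip (l2_space j A) x y)"
      by (auto simp: ell2_ip_def mult.commute infsum_cnj[symmetric] simp del: infsum_cnj)
  next
    fix x assume "x \<in> carrier (l2_space j A)"
    then show "0 \<le> Re (ip (l2_space j A) x x)"
      by (auto simp: ell2_ip_self infsum_nonneg)
  next
    fix x assume "x \<in> carrier (l2_space j A)" and ip: "ip (l2_space j A) x x = 0"
    then obtain f where f: "x = j f" "f \<in> ell2 A" by auto
    have "(cmod (f i))\<^sup>2 \<le> 0" for i
      using ell2_sum_le[OF f(2), of "{i}"] ip f by (simp add: ell2_ip_self)
    then show "x = \<zero>\<^bsub>l2_space j A\<^esub>" using f by (simp add: fun_eq_iff)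
  qed
qed

sublocale l2: inner_product_module "l2_space j A" for A
  by (rule inner_product_module_l2_space)

lemma l2_diff [simp]:
  assumes "f \<in> ell2 A" "g \<in> ell2 A"
  shows "j f \<ominus>\<^bsub>l2_space j A\<^esub> j g = j (\<lambda>i. f i - g i)"
proof -
  have "\<ominus>\<^bsub>l2_space j A\<^esub> j g = j (\<lambda>i. -1 * g i)"
    using assms ell2_scale[of g A "-1"] by (intro l2.M.minus_equality) auto
  then show ?thesis by (simp add: a_minus_def)
qed

lemma hnorm_l2: "f \<in> ell2 A \<Longrightarrow> hnorm (l2_space j A) (j f) = sqrt (\<Sum>\<^sub>\<infinity>i. (cmod (f i))\<^sup>2)"
  by (simp add: hnorm_def ell2_ip_self)

lemma ell2_sum_le_hnorm:
  assumes "f \<in> ell2 A" "finite F"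
  shows "(\<Sum>i\<in>F. (cmod (f i))\<^sup>2) \<le> (hnorm (l2_space j A) (j f))\<^sup>2"
  using ell2_sum_le[OF assms] assms(1) by (simp add: hnorm_l2 infsum_nonneg)

text \<open>A Cauchy sequence converges pointwise, and bounds on the finite partial sums of its tails
  pass to the pointwise limit.\<close>

lemma mcomplete_l2_space: "Metric_space.mcomplete (carrier (l2_space j A)) (hdist (l2_space j A))"
  unfolding l2.metric.mcomplete_def
proof (intro allI impI)
  fix x assume "l2.metric.MCauchy A x"
  then have x: "\<And>n. x n \<in> j ` ell2 A"
    and Cauchy: "\<And>\<epsilon>. \<epsilon> > 0 \<Longrightarrow> \<exists>N. \<forall>m n. N \<le> m \<longrightarrow> N \<le> n \<longrightarrow> hdist (l2_space j A) (x m) (x n) < \<epsilon>"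
    unfolding l2.metric.MCauchy_def by auto
  from x have "\<forall>n. \<exists>g. g \<in> ell2 A \<and> x n = j g" by blast
  then obtain f where f: "\<And>n. f n \<in> ell2 A" and xf: "\<And>n. x n = j (f n)" by metis
  have d: "hdist (l2_space j A) (x m) (j g) = hnorm (l2_space j A) (j (\<lambda>i. f m i - g i))"
    if "g \<in> ell2 A" for m g
    using f that by (simp add: hdist_def xf)
  have tail: "\<exists>N. \<forall>m\<ge>N. \<forall>n\<ge>N. \<forall>F. finite F \<longrightarrow> (\<Sum>i\<in>F. (cmod (f m i - f n i))\<^sup>2) \<le> \<epsilon>\<^sup>2"
    if "\<epsilon> > 0" for \<epsilon>
  proof -
    obtain N where "\<forall>m n. N \<le> m \<longrightarrow> N \<le> n \<longrightarrow> hdist (l2_space j A) (x m) (x n) < \<epsilon>"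
      using Cauchy[OF \<open>\<epsilon> > 0\<close>] by blast
    then have N: "hnorm (l2_space j A) (j (\<lambda>i. f m i - f n i)) < \<epsilon>" if "N \<le> m" "N \<le> n" for m n
      using that d[OF f[of n], of m] by (simp add: xf flip: d[OF f[of n], of m])
    show ?thesis
    proof (intro exI[of _ N] allI impI)
      fix m n F assume "N \<le> m" "N \<le> n" "finite (F :: 'i set)"
      then have "(\<Sum>i\<in>F. (cmod (f m i - f n i))\<^sup>2) \<le> (hnorm (l2_space j A) (j (\<lambda>i. f m i - f n i)))\<^sup>2"
        using f by (intro ell2_sum_le_hnorm ell2_diff)
      also have "\<dots> \<le> \<epsilon>\<^sup>2"
        using N[OF \<open>N \<le> m\<close> \<open>N \<le> n\<close>] f by (intro power_mono l2.hnorm_nonneg) (auto simp: ell2_diff)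
      finally show "(\<Sum>i\<in>F. (cmod (f m i - f n i))\<^sup>2) \<le> \<epsilon>\<^sup>2" .
    qed
  qed
  have "Cauchy (\<lambda>n. f n i)" for i
  proof (rule metric_CauchyI)
    fix \<epsilon> :: real assume "\<epsilon> > 0"
    then obtain N where N: "\<forall>m\<ge>N. \<forall>n\<ge>N. \<forall>F. finite F \<longrightarrow> (\<Sum>i\<in>F. (cmod (f m i - f n i))\<^sup>2) \<le> (\<epsilon>/2)\<^sup>2"
      using tail[of "\<epsilon>/2"] by auto
    have "dist (f m i) (f n i) < \<epsilon>" if "m \<ge> N" "n \<ge> N" for m n
    proof -
      have "(cmod (f m i - f n i))\<^sup>2 \<le> (\<epsilon>/2)\<^sup>2"
        using N[rule_format, OF that, of "{i}"] by simp
      then have "cmod (f m i - f n i) \<le> \<epsilon>/2"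
        by (rule power2_le_imp_le) (use \<open>\<epsilon> > 0\<close> in simp)
      then show ?thesis using \<open>\<epsilon> > 0\<close> by (simp add: dist_norm)
    qed
    then show "\<exists>N. \<forall>m\<ge>N. \<forall>n\<ge>N. dist (f m i) (f n i) < \<epsilon>" by blast
  qed
  then have "\<forall>i. \<exists>c. (\<lambda>n. f n i) \<longlonglongrightarrow> c"
    by (simp add: Cauchy_convergent_iff convergent_def)
  then obtain g where lim: "\<And>i. (\<lambda>n. f n i) \<longlonglongrightarrow> g i" by metis
  have g_off: "g i = 0" if "i \<notin> A" for i
    using lim[of i] by (simp add: ell2_off[OF f that] LIMSEQ_const_iff)
  have near: "\<exists>N. \<forall>m\<ge>N. (\<lambda>i. f m i - g i) \<in> ell2 A \<and> hnorm (l2_space j A) (j (\<lambda>i. f m i - g i)) \<le> \<epsilon>"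
    if \<epsilon>: "\<epsilon> > 0" for \<epsilon>
  proof -
    obtain N where N: "\<forall>m\<ge>N. \<forall>n\<ge>N. \<forall>F. finite F \<longrightarrow> (\<Sum>i\<in>F. (cmod (f m i - f n i))\<^sup>2) \<le> \<epsilon>\<^sup>2"
      using tail[OF \<epsilon>] by blast
    have "(\<lambda>i. f m i - g i) \<in> ell2 A \<and> hnorm (l2_space j A) (j (\<lambda>i. f m i - g i)) \<le> \<epsilon>"
      if "m \<ge> N" for m
    proof -
      have sums: "(\<Sum>i\<in>F. (cmod (f m i - g i))\<^sup>2) \<le> \<epsilon>\<^sup>2" if "finite F" for F
      proof (rule tendsto_upperbound)
        show "(\<lambda>n. \<Sum>i\<in>F. (cmod (f m i - f n i))\<^sup>2) \<longlonglongrightarrow> (\<Sum>i\<in>F. (cmod (f m i - g i))\<^sup>2)"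
          by (intro tendsto_intros lim)
        show "\<forall>\<^sub>F n in sequentially. (\<Sum>i\<in>F. (cmod (f m i - f n i))\<^sup>2) \<le> \<epsilon>\<^sup>2"
          using N \<open>m \<ge> N\<close> that by (auto simp: eventually_sequentially)
      qed simp
      have mem: "(\<lambda>i. f m i - g i) \<in> ell2 A"
        by (rule ell2_bounded_sums(1)[OF _ sums]) (simp add: g_off ell2_off[OF f])
      have "(\<Sum>\<^sub>\<infinity>i. (cmod (f m i - g i))\<^sup>2) \<le> \<epsilon>\<^sup>2"
        by (rule ell2_bounded_sums(2)[OF _ sums, of A]) (simp add: g_off ell2_off[OF f])
      then have "hnorm (l2_space j A) (j (\<lambda>i. f m i - g i)) \<le> \<epsilon>"
        using mem \<epsilon> by (simp add: hnorm_l2 real_le_lsqrt)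
      with mem show ?thesis by blast
    qed
    then show ?thesis by blast
  qed
  obtain m where "(\<lambda>i. f m i - g i) \<in> ell2 A"
    using near[of 1] by force
  from ell2_diff[OF f[of m] this] have g: "g \<in> ell2 A" by simp
  have "\<exists>N. \<forall>m\<ge>N. x m \<in> carrier (l2_space j A) \<and> hdist (l2_space j A) (x m) (j g) < \<epsilon>" if "\<epsilon> > 0" for \<epsilon>
  proof -
    obtain N where "\<forall>m\<ge>N. hnorm (l2_space j A) (j (\<lambda>i. f m i - g i)) \<le> \<epsilon> / 2"
      using near[of "\<epsilon>/2"] \<open>\<epsilon> > 0\<close> by auto
    then show ?thesis
      using that d[OF g] x by (intro exI[of _ N]) fastforce
  qed
  then have "limitin (l2.metric.mtopology A) x (j g) sequentially"
    unfolding l2.metric.limit_metric_sequentially using g by simp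
  then show "\<exists>l. limitin (l2.metric.mtopology A) x l sequentially" ..
qed

sublocale l2: complex_hilbert "l2_space j A" for A
  by unfold_locales (rule mcomplete_l2_space)

text \<open>Membership of \<open>f\<close> in a closed subspace only needs, for each finite set, an element that agrees
  with \<open>f\<close> there and differs from it elsewhere by at most a fixed square-summable \<open>h\<close>: the finite
  set can be chosen to carry all but a small part of \<open>h\<close>.\<close>

lemma closed_subspace_approx:
  assumes M: "closed_subspace (l2_space j A) M"
    and f: "f \<in> ell2 A" and h: "h \<in> ell2 A"
    and approx: "\<And>F. finite F \<Longrightarrow> \<exists>g\<in>ell2 A. j g \<in> M \<and>
      (\<forall>i. cmod (f i - g i) \<le> (if i \<in> F then 0 else cmod (h i)))"
  shows "j f \<in> M"
proof (rule l2.closed_subspace_limit[OF M])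
  show "j f \<in> carrier (l2_space j A)" using f by simp
  fix r :: real assume r: "r > 0"
  then have "(r/2)\<^sup>2 > 0" by simp
  from infsum_finite_approximation[OF ell2_summable[OF h] this]
  obtain F where F: "finite F"
    and Fh: "dist (\<Sum>i\<in>F. (cmod (h i))\<^sup>2) (\<Sum>\<^sub>\<infinity>i. (cmod (h i))\<^sup>2) \<le> (r/2)\<^sup>2"
    by blast
  from approx[OF F] obtain g where g: "g \<in> ell2 A" "j g \<in> M"
    and fg: "\<And>i. cmod (f i - g i) \<le> (if i \<in> F then 0 else cmod (h i))" by blast
  have "(\<Sum>\<^sub>\<infinity>i. (cmod (f i - g i))\<^sup>2) \<le> (r/2)\<^sup>2"
  proof (rule infsum_le_finite_sums)
    show "(\<lambda>i. (cmod (f i - g i))\<^sup>2) summable_on UNIV"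
      using f g by (intro ell2_summable[of _ A] ell2_diff)
    fix G assume G: "finite (G :: 'i set)"
    have "(\<Sum>i\<in>G. (cmod (f i - g i))\<^sup>2) \<le> (\<Sum>i\<in>G. if i \<in> F then 0 else (cmod (h i))\<^sup>2)"
    proof (rule sum_mono)
      fix i show "(cmod (f i - g i))\<^sup>2 \<le> (if i \<in> F then 0 else (cmod (h i))\<^sup>2)"
        using fg[of i] by (auto intro: power_mono split: if_splits)
    qed
    also have "\<dots> = (\<Sum>i\<in>G - F. (cmod (h i))\<^sup>2)"
      using G by (intro sum.mono_neutral_cong_right) auto
    also have "\<dots> = (\<Sum>i\<in>(G - F) \<union> F. (cmod (h i))\<^sup>2) - (\<Sum>i\<in>F. (cmod (h i))\<^sup>2)"
      using F G by (subst sum.union_disjoint) auto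
    also have "\<dots> \<le> (\<Sum>\<^sub>\<infinity>i. (cmod (h i))\<^sup>2) - (\<Sum>i\<in>F. (cmod (h i))\<^sup>2)"
      using ell2_sum_le[OF h, of "(G - F) \<union> F"] F G by simp
    also have "\<dots> \<le> (r/2)\<^sup>2"
      using Fh by (simp add: dist_real_def)
    finally show "(\<Sum>i\<in>G. (cmod (f i - g i))\<^sup>2) \<le> (r/2)\<^sup>2" .
  qed
  then have "sqrt (\<Sum>\<^sub>\<infinity>i. (cmod (f i - g i))\<^sup>2) \<le> r/2"
    using r by (intro real_le_lsqrt) auto
  then have "hnorm (l2_space j A) (j f \<ominus>\<^bsub>l2_space j A\<^esub> j g) \<le> r/2"
    using f g by (simp add: hnorm_l2 ell2_diff)
  then show "\<exists>y\<in>M. hnorm (l2_space j A) (j f \<ominus>\<^bsub>l2_space j A\<^esub> y) < r"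
    using g r by force
qed

lemma submodule_facts:
  assumes "closed_subspace (l2_space j A) M"
  shows "M \<subseteq> j ` ell2 A" "j (\<lambda>_. 0) \<in> M"
    "\<And>f g. \<lbrakk>j f \<in> M; j g \<in> M\<rbrakk> \<Longrightarrow> j (\<lambda>i. f i + g i) \<in> M"
    "\<And>c f. j f \<in> M \<Longrightarrow> j (\<lambda>i. c * f i) \<in> M"
proof -
  interpret submodule M complex_field "l2_space j A"
    using assms by (simp add: closed_subspace_def)
  show "M \<subseteq> j ` ell2 A" using subset by simp
  show "j (\<lambda>_. 0) \<in> M" using one_closed by simp
  show "\<And>f g. \<lbrakk>j f \<in> M; j g \<in> M\<rbrakk> \<Longrightarrow> j (\<lambda>i. f i + g i) \<in> M"
    using m_closed by fastforce
  show "\<And>c f. j f \<in> M \<Longrightarrow> j (\<lambda>i. c * f i) \<in> M"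
    using smult_closed by fastforce
qed

lemma closed_subspace_of_deltas:
  assumes M: "closed_subspace (l2_space j A) M" and \<delta>: "\<And>b. b \<in> A \<Longrightarrow> j (delta b) \<in> M"
  shows "M = carrier (l2_space j A)"
proof -
  note sub = submodule_facts[OF M]
  have restr: "j (\<lambda>i. if i \<in> F then f i else 0) \<in> M" if "f \<in> ell2 A" "finite F" for f F
    using that(2)
  proof (induction F)
    case empty
    then show ?case using sub(2) by simp
  next
    case (insert b F)
    have "j (\<lambda>i. f b * delta b i) \<in> M"
      using \<delta>[of b] sub(2) sub(4) ell2_off[OF that(1), of b] by (cases "b \<in> A") auto
    from sub(3)[OF this insert.IH] show ?case
      by (rule back_subst[of "\<lambda>x. x \<in> M"])
         (use insert.hyps in \<open>auto simp: delta_def fun_eq_iff\<close>)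
  qed
  have "j f \<in> M" if f: "f \<in> ell2 A" for f
  proof (rule closed_subspace_approx[OF M f f])
    fix F :: "'i set" assume F: "finite F"
    have "(\<lambda>i. if i \<in> F then f i else 0) \<in> ell2 A"
      by (rule ell2_dominated[OF f]) (use f in \<open>auto simp: ell2_off\<close>)
    with restr[OF f F] show "\<exists>g\<in>ell2 A. j g \<in> M \<and>
        (\<forall>i. cmod (f i - g i) \<le> (if i \<in> F then 0 else cmod (f i)))"
      by (intro bexI[of _ "\<lambda>i. if i \<in> F then f i else 0"]) auto
  qed
  with sub(1) show ?thesis by auto
qed

end

section \<open>Totally ordered groups\<close>

locale total_cone =
  fixes P :: "'g::ab_group_add set"
  assumes cone: "positive_cone P"
begin

lemma add_mem: "a \<in> P \<Longrightarrow> b \<in> P \<Longrightarrow> a + b \<in> P"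
  using cone by (simp add: positive_cone_def)

lemma zero_mem [simp]: "0 \<in> P"
  using cone by (auto simp: positive_cone_def)

lemma total: "a - b \<in> P \<or> b - a \<in> P"
proof -
  have "a - b \<in> P \<union> uminus ` P" using cone by (simp add: positive_cone_def)
  then show ?thesis by (metis UnE imageE minus_diff_eq minus_minus)
qed

lemma antisym: "a - b \<in> P \<Longrightarrow> b - a \<in> P \<Longrightarrow> a = b"
proof -
  assume "a - b \<in> P" "b - a \<in> P"
  then have "a - b \<in> P \<inter> uminus ` P" by (metis IntI imageI minus_diff_eq)
  then have "a - b \<in> {0}" using cone unfolding positive_cone_def by blast
  then show "a = b" by simp
qed

lemma uminus_mem_iff: "a \<in> P \<Longrightarrow> - a \<in> P \<longleftrightarrow> a = 0"
  using antisym[of a 0] by auto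

lemma trans: "a - b \<in> P \<Longrightarrow> b - c \<in> P \<Longrightarrow> a - c \<in> P"
  using add_mem[of "a - b" "b - c"] by simp

lemma finite_has_least: "finite F \<Longrightarrow> F \<noteq> {} \<Longrightarrow> \<exists>m\<in>F. \<forall>x\<in>F. x - m \<in> P"
proof (induction F rule: finite_ne_induct)
  case (singleton x)
  then show ?case by simp
next
  case (insert x F)
  then obtain m where m: "m \<in> F" "\<forall>y\<in>F. y - m \<in> P" by blast
  show ?case
  proof (cases "m - x \<in> P")
    case True
    with m have "\<forall>y\<in>insert x F. y - x \<in> P" by (auto intro: trans)
    then show ?thesis by blast
  next
    case False
    with total[of m x] m have "\<forall>y\<in>insert x F. y - m \<in> P" by auto
    with m show ?thesis by blast
  qed
qed

lemma finite_has_greatest: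
  assumes "finite F" "F \<noteq> {}"
  shows "\<exists>m\<in>F. \<forall>x\<in>F. m - x \<in> P"
  using finite_has_least[of "uminus ` F"] assms by (auto simp: algebra_simps)

end

section \<open>Translation representations\<close>

definition translation :: "(('g::ab_group_add \<Rightarrow> complex) \<Rightarrow> 'u) \<Rightarrow> 'g \<Rightarrow> 'u \<Rightarrow> 'u" where
  "translation j a x = j (\<lambda>i. inv_into UNIV j x (i - a))"

locale translation_model = l2_model j + total_cone P
  for j :: "('g::ab_group_add \<Rightarrow> complex) \<Rightarrow> 'u" and P :: "'g set" +
  fixes A :: "'g set"
  assumes upward: "a \<in> P \<Longrightarrow> x \<in> A \<Longrightarrow> a + x \<in> A"
begin

lemma translation_j [simp]: "translation j a (j f) = j (\<lambda>i. f (i - a))"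
  by (simp add: translation_def)

lemma ell2_shift:
  assumes "a \<in> P" "f \<in> ell2 A"
  shows "(\<lambda>i. f (i - a)) \<in> ell2 A"
proof -
  have "bij_betw (\<lambda>i. i - a) UNIV UNIV"
    by (rule bij_betwI[where g = "\<lambda>i. i + a"]) auto
  from summable_on_reindex_bij_betw[OF this, of "\<lambda>i. (cmod (f i))\<^sup>2"]
  have "(\<lambda>i. (cmod (f (i - a)))\<^sup>2) summable_on UNIV"
    using ell2_summable[OF assms(2)] by simp
  moreover have "f (i - a) = 0" if "i \<notin> A" for i
    using upward[OF assms(1), of "i - a"] that ell2_off[OF assms(2), of "i - a"] by auto
  ultimately show ?thesis by (simp add: ell2_def)
qed

lemma ell2_shift_back:
  assumes "f \<in> ell2 A"
  shows "(\<lambda>i. if i \<in> A then f (i + a) else 0) \<in> ell2 A"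
proof -
  have "bij_betw (\<lambda>i. i + a) UNIV UNIV"
    by (rule bij_betwI[where g = "\<lambda>i. i - a"]) auto
  from summable_on_reindex_bij_betw[OF this, of "\<lambda>i. (cmod (f i))\<^sup>2"]
  have "(\<lambda>i. f (i + a)) \<in> ell2 UNIV"
    using ell2_summable[OF assms] by (simp add: ell2_def)
  then show ?thesis by (rule ell2_dominated) auto
qed

lemma ell2_ip_shift:
  assumes "a \<in> P" "f \<in> ell2 A"
  shows "ell2_ip (\<lambda>i. f (i - a)) g = ell2_ip f (\<lambda>i. if i \<in> A then g (i + a) else 0)"
  unfolding ell2_ip_def
  by (rule infsum_reindex_bij_witness[of _ "\<lambda>i. i + a" "\<lambda>i. i - a"])
     (use ell2_off[OF assms(2)] in auto)

lemma hadjoint_translation: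
  assumes "a \<in> P" "g \<in> ell2 A"
  shows "hadjoint (l2_space j A) (translation j a) (j g) = j (\<lambda>i. if i \<in> A then g (i + a) else 0)"
  by (rule l2.hadjoint_eqI) (use assms in \<open>auto simp: ell2_shift_back ell2_ip_shift ell2_shift\<close>)

lemma translation_delta: "(\<lambda>i. delta b (i - a)) = delta (a + b)" for a b :: 'g
  by (auto simp: delta_def fun_eq_iff algebra_simps)

lemma isometric_translation: "isometric_rep P (l2_space j A, translation j)"
proof -
  have "isometry (l2_space j A) (l2_space j A) (translation j a)" if a: "a \<in> P" for a
  proof -
    have "(\<Sum>\<^sub>\<infinity>i. (cmod (f (i - a)))\<^sup>2) = (\<Sum>\<^sub>\<infinity>i. (cmod (f i))\<^sup>2)" for f
      by (rule infsum_reindex_bij_witness[of _ "\<lambda>i. i + a" "\<lambda>i. i - a"]) auto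
    then show ?thesis
      using a by (auto simp: isometry_def hlinear_def ell2_shift hnorm_l2)
  qed
  moreover have "hilbert_space (l2_space j A)"
    by (simp add: hilbert_space_iff l2.complex_hilbert_axioms)
  ultimately show ?thesis
    by (auto simp: isometric_rep_def algebra_simps)
qed

lemma faithful_translation:
  assumes "A \<noteq> {}"
  shows "faithful_rep P (l2_space j A, translation j)"
proof -
  obtain x where x: "x \<in> A" using assms by blast
  have "a = b" if eq: "restrict (translation j a) (j ` ell2 A) = restrict (translation j b) (j ` ell2 A)" for a b
  proof -
    from fun_cong[OF eq, of "j (delta x)"] x have "delta (a + x) = delta (b + x)"
      by (simp add: delta_ell2 translation_delta)
    from fun_cong[OF this, of "a + x"] show "a = b"
      by (simp add: delta_def split: if_splits)
  qed
  then show ?thesis by (auto simp: faithful_rep_def inj_on_def)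
qed

lemma nonunitary_translation:
  assumes "\<And>a. a \<in> P \<Longrightarrow> a \<noteq> 0 \<Longrightarrow> \<exists>x\<in>A. x - a \<notin> A"
  shows "nonunitary_rep P (l2_space j A, translation j)"
proof -
  have "\<not> unitary (l2_space j A) (l2_space j A) (translation j a)" if "a \<in> P" "a \<noteq> 0" for a
  proof
    assume "unitary (l2_space j A) (l2_space j A) (translation j a)"
    then have onto: "translation j a ` j ` ell2 A = j ` ell2 A" by (simp add: unitary_def)
    obtain x where x: "x \<in> A" "x - a \<notin> A" using assms \<open>a \<in> P\<close> \<open>a \<noteq> 0\<close> by blast
    then have "j (delta x) \<in> translation j a ` j ` ell2 A"
      by (simp add: onto delta_ell2)
    then obtain f where f: "f \<in> ell2 A" "delta x = (\<lambda>i. f (i - a))" by auto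
    from fun_cong[OF f(2), of x] ell2_off[OF f(1) x(2)] show False
      by (simp add: delta_def)
  qed
  then show ?thesis by (auto simp: nonunitary_rep_def)
qed

text \<open>An invariant subspace that contains a function \<open>f\<close> with \<open>f b \<noteq> 0\<close> contains its restrictions to
  the differences of \<open>a + A\<close> and \<open>c + A\<close>. When these differences separate \<open>b\<close> from each finite set of
  other points, the restrictions come arbitrarily close to \<open>f b\<close> times \<open>\<delta>\<^sub>b\<close>. Translations and their
  adjoints carry \<open>\<delta>\<^sub>b\<close> to all other unit vectors.\<close>

lemma irreducible_translation:
  assumes sep: "\<And>b F. \<lbrakk>b \<in> A; finite F\<rbrakk> \<Longrightarrow> \<exists>a\<in>P. \<exists>c\<in>P. b - a \<in> A \<and> b - c \<notin> A \<and>
      (\<forall>x\<in>F \<inter> A. x \<noteq> b \<longrightarrow> x - a \<in> A \<longrightarrow> x - c \<in> A)"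
  shows "irreducible_rep P (l2_space j A, translation j)"
  unfolding irreducible_rep_def
proof (clarsimp)
  fix M assume M: "closed_subspace (l2_space j A) M"
    and inv: "\<forall>a\<in>P. translation j a ` M \<subseteq> M \<and> hadjoint (l2_space j A) (translation j a) ` M \<subseteq> M"
    and ne: "M \<noteq> j ` ell2 A"
  note sub = submodule_facts[OF M]
  have V: "j (\<lambda>i. f (i - a)) \<in> M" if "a \<in> P" "j f \<in> M" for a f
    using inv that by force
  have V': "j (\<lambda>i. if i \<in> A then f (i + a) else 0) \<in> M" if "a \<in> P" "j f \<in> M" for a f
  proof -
    have "f \<in> ell2 A" using sub(1) that(2) by auto
    with inv that show ?thesis by (force simp flip: hadjoint_translation)
  qed
  show "M = {j (\<lambda>_. 0)}"
  proof (rule ccontr)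
    assume "M \<noteq> {j (\<lambda>_. 0)}"
    then obtain f where f: "f \<in> ell2 A" "j f \<in> M" "f \<noteq> (\<lambda>_. 0)"
      using sub(1,2) by blast
    then obtain b where fb: "f b \<noteq> 0" by (auto simp: fun_eq_iff)
    then have b: "b \<in> A" using ell2_off[OF f(1)] by blast
    \<comment> \<open>\<open>V\<^sub>a V\<^sub>a\<^sup>*\<close> is the restriction to \<open>a + A\<close>.\<close>
    have Q: "j (\<lambda>i. if i - a \<in> A then f i else 0) \<in> M" if "a \<in> P" for a
      using V[OF that V'[OF that f(2)]] by (simp cong: if_cong)
    have "j (\<lambda>i. f b * delta b i) \<in> M"
    proof (rule closed_subspace_approx[OF M _ f(1)])
      show "(\<lambda>i. f b * delta b i) \<in> ell2 A" using b by (intro ell2_scale delta_ell2)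
      fix F :: "'g set" assume "finite F"
      then obtain a c where ac: "a \<in> P" "c \<in> P" "b - a \<in> A" "b - c \<notin> A"
        and F: "\<And>x. \<lbrakk>x \<in> F; x \<in> A; x \<noteq> b; x - a \<in> A\<rbrakk> \<Longrightarrow> x - c \<in> A"
        using sep[OF b] by (metis IntI)
      define g where "g i = (if i - a \<in> A then f i else 0) + (-1) * (if i - c \<in> A then f i else 0)" for i
      have gM: "j g \<in> M"
        unfolding g_def by (rule sub(3)[OF Q[OF ac(1)] sub(4)[OF Q[OF ac(2)], of "-1"]])
      then have g: "g \<in> ell2 A" using sub(1) by auto
      have "cmod (f b * delta b i - g i) \<le> (if i \<in> F then 0 else cmod (f i))" for i
      proof -
        have "a - c \<notin> P" using upward[of "a - c" "b - a"] ac(3,4) by auto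
        with total have "c - a \<in> P" by blast
        then have "i - a \<in> A" if "i - c \<in> A" using upward[OF _ that, of "c - a"] by simp
        then have "g i = (if i - a \<in> A \<and> i - c \<notin> A then f i else 0)" by (auto simp: g_def)
        then show ?thesis using F[of i] ac(3,4) ell2_off[OF f(1), of i] by (auto simp: delta_def)
      qed
      with g gM show "\<exists>g\<in>ell2 A. j g \<in> M \<and>
          (\<forall>i. cmod (f b * delta b i - g i) \<le> (if i \<in> F then 0 else cmod (f i)))" by blast
    qed
    from sub(4)[OF this, of "1 / f b"] have \<delta>b: "j (delta b) \<in> M" using fb by simp
    have "j (delta c) \<in> M" if c: "c \<in> A" for c
    proof (cases "c - b \<in> P")
      case True
      from V[OF this \<delta>b] show ?thesis by (simp add: translation_delta)
    next
      case False
      with total have "b - c \<in> P" by blast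
      from V'[OF this \<delta>b] show ?thesis
        by (rule back_subst[of "\<lambda>x. x \<in> M"]) (use c in \<open>auto simp: delta_def fun_eq_iff\<close>)
    qed
    from closed_subspace_of_deltas[OF M this] ne show False by simp
  qed
qed

end

section \<open>Two representations of an ordered group\<close>

locale cone_representations = l2_model j + total_cone P
  for j :: "('g::ab_group_add \<Rightarrow> complex) \<Rightarrow> 'u" and P :: "'g set" +
  assumes nontrivial: "P \<noteq> {0}"
begin

lemma obtain_positive: obtains p where "p \<in> P" "p \<noteq> 0"
  using nontrivial zero_mem by blast

lemma positive_add: "a \<in> P \<Longrightarrow> b \<in> P - {0} \<Longrightarrow> a + b \<in> P - {0}"
  using add_mem[of a b] uminus_mem_iff[of b] by (auto simp: add_eq_0_iff2)

sublocale full: translation_model j P P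
  by unfold_locales (rule add_mem)

sublocale punctured: translation_model j P "P - {0}"
  by unfold_locales (rule positive_add)

lemma full_admissible: "(l2_space j P, translation j) \<in> admissible_reps P"
proof -
  have "\<exists>x\<in>P. x - a \<notin> P" if "a \<in> P" "a \<noteq> 0" for a
    using that uminus_mem_iff[of a] by (intro bexI[of _ 0]) auto
  then have "nonunitary_rep P (l2_space j P, translation j)"
    by (rule full.nonunitary_translation)
  moreover have "irreducible_rep P (l2_space j P, translation j)"
  proof (rule full.irreducible_translation)
    fix b and F :: "'g set" assume b: "b \<in> P" and F: "finite F"
    obtain p where p: "p \<in> P" "p \<noteq> 0" by (rule obtain_positive)
    \<comment> \<open>Restrict to \<open>{b..<c}\<close>, where \<open>c\<close> is after \<open>b\<close> and no point of \<open>F\<close> lies strictly between.\<close>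
    define C where "C = insert (b + p) {x \<in> F. x - b \<in> P \<and> x \<noteq> b}"
    have "finite C" "C \<noteq> {}" using F by (auto simp: C_def)
    then obtain c where c: "c \<in> C" "\<forall>x\<in>C. x - c \<in> P"
      using finite_has_least by blast
    then have cb: "c - b \<in> P" "c \<noteq> b" using p by (auto simp: C_def)
    then have "c \<in> P" using add_mem[of "c - b" b] b by simp
    moreover have "b - c \<notin> P" using antisym cb by blast
    ultimately show "\<exists>a\<in>P. \<exists>c\<in>P. b - a \<in> P \<and> b - c \<notin> P \<and>
        (\<forall>x\<in>F \<inter> P. x \<noteq> b \<longrightarrow> x - a \<in> P \<longrightarrow> x - c \<in> P)"
      using c(2) b by (intro bexI[of _ b] bexI[of _ c]) (auto simp: C_def)
  qed
  moreover have "P \<noteq> {}" using zero_mem by blast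
  ultimately show ?thesis
    using full.isometric_translation full.faithful_translation by (auto simp: admissible_reps_def)
qed

lemma punctured_admissible: "(l2_space j (P - {0}), translation j) \<in> admissible_reps P"
proof -
  have "\<exists>x\<in>P - {0}. x - a \<notin> P - {0}" if "a \<in> P" "a \<noteq> 0" for a
    using that by (intro bexI[of _ a]) auto
  then have "nonunitary_rep P (l2_space j (P - {0}), translation j)"
    by (rule punctured.nonunitary_translation)
  moreover have "irreducible_rep P (l2_space j (P - {0}), translation j)"
  proof (rule punctured.irreducible_translation)
    fix b and F :: "'g set" assume b: "b \<in> P - {0}" and F: "finite F"
    \<comment> \<open>Restrict to \<open>{a<..b}\<close>, where \<open>a\<close> is the last point of \<open>F \<inter> P\<close> before \<open>b\<close>, or 0 if there is none.\<close>
    define B where "B = insert 0 {x \<in> F. x \<in> P \<and> b - x \<in> P \<and> x \<noteq> b}"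
    have "finite B" "B \<noteq> {}" using F by (auto simp: B_def)
    then obtain a where a: "a \<in> B" "\<forall>x\<in>B. a - x \<in> P"
      using finite_has_greatest by blast
    then have "a \<in> P" "b - a \<in> P - {0}" using b by (auto simp: B_def)
    moreover have "x - b \<in> P - {0}" if x: "x \<in> F \<inter> (P - {0})" "x \<noteq> b" "x - a \<in> P - {0}" for x
    proof (rule ccontr)
      assume "x - b \<notin> P - {0}"
      with x total[of x b] have "b - x \<in> P" by auto
      with a(2) x have "a - x \<in> P" by (auto simp: B_def)
      with antisym[of a x] x show False by auto
    qed
    ultimately show "\<exists>a\<in>P. \<exists>c\<in>P. b - a \<in> P - {0} \<and> b - c \<notin> P - {0} \<and>
        (\<forall>x\<in>F \<inter> (P - {0}). x \<noteq> b \<longrightarrow> x - a \<in> P - {0} \<longrightarrow> x - c \<in> P - {0})"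
      using b by (intro bexI[of _ a] bexI[of _ b]) auto
  qed
  moreover have "P - {0} \<noteq> {}" using obtain_positive by blast
  ultimately show ?thesis
    using punctured.isometric_translation punctured.faithful_translation
    by (auto simp: admissible_reps_def)
qed

text \<open>On \<open>P\<close> the vector \<open>\<delta>\<^sub>0\<close> is orthogonal to the ranges of all \<open>V\<^sub>a\<close> with \<open>a \<noteq> 0\<close>, and a unitary
  intertwiner preserves this. On \<open>P - {0}\<close>, when every positive element is a sum of two positive
  elements, these ranges contain all unit vectors \<open>\<delta>\<^sub>c\<close>.\<close>

lemma full_punctured_inequivalent:
  assumes dense: "\<And>a. a \<in> P - {0} \<Longrightarrow> \<exists>b\<in>P - {0}. a - b \<in> P - {0}"
  shows "\<not> unitarily_equivalent P (l2_space j P, translation j) (l2_space j (P - {0}), translation j)"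
proof
  assume "unitarily_equivalent P (l2_space j P, translation j) (l2_space j (P - {0}), translation j)"
  then obtain U where U: "unitary (l2_space j P) (l2_space j (P - {0})) U"
    and UV: "\<And>a x. \<lbrakk>a \<in> P; x \<in> j ` ell2 P\<rbrakk> \<Longrightarrow> U (translation j a x) = translation j a (U x)"
    unfolding unitarily_equivalent_def prod.case l2_space_simps by blast
  have iso: "isometry (l2_space j P) (l2_space j (P - {0})) U"
    and onto: "U ` j ` ell2 P = j ` ell2 (P - {0})" using U by (auto simp: unitary_def)
  note U_ip = isometry_ip[OF inner_product_module_l2_space inner_product_module_l2_space iso]
  have \<delta>: "j (delta 0) \<in> carrier (l2_space j P)" by (simp add: delta_ell2)
  then obtain g where g: "U (j (delta 0)) = j g" "g \<in> ell2 (P - {0})" using onto by auto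
  have "g c = 0" if c: "c \<in> P - {0}" for c
  proof -
    obtain a where a: "a \<in> P - {0}" "c - a \<in> P - {0}" using dense[OF c] by blast
    then have "j (delta (c - a)) \<in> U ` j ` ell2 P" by (simp add: onto delta_ell2)
    then obtain f where f: "f \<in> ell2 P" "U (j f) = j (delta (c - a))" by auto
    have "j (delta c) = U (translation j a (j f))"
      using a f UV[of a "j f"] by (simp add: full.translation_delta)
    also have "\<dots> = U (j (\<lambda>i. f (i - a)))" by simp
    finally have eq: "j (delta c) = U (j (\<lambda>i. f (i - a)))" .
    have "ell2_ip (delta c) g = ip (l2_space j (P - {0})) (U (j (\<lambda>i. f (i - a)))) (U (j (delta 0)))"
      using g by (simp flip: eq)
    also have "\<dots> = ell2_ip (\<lambda>i. f (i - a)) (delta 0)"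
      using a f by (subst U_ip) (auto simp: full.ell2_shift delta_ell2)
    also have "\<dots> = f (- a)" by (simp add: ell2_ip_delta)
    also have "\<dots> = 0" using a uminus_mem_iff[of a] by (intro ell2_off[OF f(1)]) auto
    finally have "ell2_ip (delta c) g = 0" .
    then have "ell2_ip g (delta c) = 0"
      using l2.ip_commute[of "j (delta c)" "P - {0}" "j g"] c g by (simp add: delta_ell2)
    then show ?thesis by (simp add: ell2_ip_delta)
  qed
  with g have "g = (\<lambda>_. 0)" by (auto simp: fun_eq_iff ell2_def)
  with U_ip[OF \<delta> \<delta>] g have "ell2_ip (delta 0) (delta 0 :: 'g \<Rightarrow> complex) = 0"
    by (simp add: ell2_ip_def)
  then show False by (simp add: ell2_ip_delta) (simp add: delta_def)
qed

end

section \<open>Representations with a wandering vector\<close>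

lemma (in inner_product_module) Bessel_inequality:
  assumes u: "\<And>b. b \<in> A \<Longrightarrow> u b \<in> carrier H"
    and orthonormal: "\<And>b c. \<lbrakk>b \<in> A; c \<in> A\<rbrakk> \<Longrightarrow> ip H (u b) (u c) = (if b = c then 1 else 0)"
    and F: "finite F" "F \<subseteq> A" and y: "y \<in> carrier H"
  shows "(\<Sum>b\<in>F. (cmod (ip H y (u b)))\<^sup>2) \<le> (hnorm H y)\<^sup>2"
  using F y
proof (induction F arbitrary: y)
  case (insert c F)
  \<comment> \<open>Removing the component along \<open>u c\<close> lowers the square norm by exactly one summand.\<close>
  define y' where "y' = y \<ominus> ip H y (u c) \<odot> u c"
  have c: "c \<in> A" "u c \<in> carrier H" and F: "F \<subseteq> A" using insert.prems u by auto
  have y': "y' \<in> carrier H" using insert.prems c by (simp add: y'_def)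
  have nc: "(hnorm H (u c))\<^sup>2 = 1" using hnorm_square[OF c(2)] orthonormal[OF c(1) c(1)] by simp
  have "(hnorm H y')\<^sup>2 = (hnorm H y)\<^sup>2 + (cmod (ip H y (u c)))\<^sup>2 - 2 * Re (cnj (ip H y (u c)) * ip H y (u c))"
    using insert.prems c nc
    by (simp add: y'_def hnorm_diff_square hnorm_smult ip_smult_right power_mult_distrib)
  also have "cnj (ip H y (u c)) * ip H y (u c) = of_real ((cmod (ip H y (u c)))\<^sup>2)"
    by (simp only: complex_norm_square mult.commute)
  finally have "(hnorm H y')\<^sup>2 + (cmod (ip H y (u c)))\<^sup>2 = (hnorm H y)\<^sup>2" by simp
  moreover have "ip H y' (u b) = ip H y (u b)" if "b \<in> F" for b
  proof -
    have b: "b \<in> A" "b \<noteq> c" using that F insert.hyps by auto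
    then show ?thesis
      using insert.prems c u[OF b(1)] orthonormal[OF c(1) b(1)] by (simp add: y'_def ip_simps)
  qed
  then have "(\<Sum>b\<in>F. (cmod (ip H y (u b)))\<^sup>2) \<le> (hnorm H y')\<^sup>2"
    using insert.IH[OF F y'] by simp
  ultimately show ?case using insert.hyps by simp
qed simp

locale isometric_representation = complex_hilbert H + total_cone P
  for H :: "'a hilbert" and P :: "'g::ab_group_add set" +
  fixes V :: "'g \<Rightarrow> 'a \<Rightarrow> 'a"
  assumes isometric: "isometric_rep P (H, V)"
begin

lemma V_isometry: "a \<in> P \<Longrightarrow> isometry H H (V a)"
  using isometric by (simp add: isometric_rep_def)

lemma V_mem [simp]: "a \<in> P \<Longrightarrow> x \<in> carrier H \<Longrightarrow> V a x \<in> carrier H"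
  using V_isometry[of a] by (auto simp: isometry_def hlinear_def)

lemma V_0 [simp]: "x \<in> carrier H \<Longrightarrow> V 0 x = x"
  using isometric by (simp add: isometric_rep_def)

lemma V_V: "\<lbrakk>a \<in> P; b \<in> P; x \<in> carrier H\<rbrakk> \<Longrightarrow> V a (V b x) = V (a + b) x"
  using isometric by (simp add: isometric_rep_def)

lemma V_ip: "\<lbrakk>a \<in> P; x \<in> carrier H; y \<in> carrier H\<rbrakk> \<Longrightarrow> ip H (V a x) (V a y) = ip H x y"
  using isometry_ip[OF inner_product_module_axioms inner_product_module_axioms V_isometry] by blast

text \<open>If \<open>e\<close> is the least positive element, the ranges of all \<open>V\<^sub>a\<close> with \<open>a \<noteq> 0\<close> are contained in the
  range of \<open>V\<^sub>e\<close>, so it suffices to find a vector orthogonal to that range, which is a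
  proper closed subspace because \<open>V\<^sub>e\<close> is not unitary.\<close>

lemma wandering_vector_exists:
  assumes nonunitary: "nonunitary_rep P (H, V)"
    and e: "e \<in> P" "e \<noteq> 0" and least: "\<And>a. \<lbrakk>a \<in> P; a \<noteq> 0\<rbrakk> \<Longrightarrow> a - e \<in> P"
  obtains \<xi> where "\<xi> \<in> carrier H" "hnorm H \<xi> = 1"
    "\<And>a x. \<lbrakk>a \<in> P; a \<noteq> 0; x \<in> carrier H\<rbrakk> \<Longrightarrow> ip H (V a x) \<xi> = 0"
proof -
  have "\<not> unitary H H (V e)" using nonunitary e by (auto simp: nonunitary_rep_def)
  with V_isometry[OF e(1)] V_mem[OF e(1)]
  obtain w where w: "w \<in> carrier H" "w \<notin> V e ` carrier H" unfolding unitary_def by blast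
  \<comment> \<open>\<open>V\<^sub>e V\<^sub>e\<^sup>*\<close> is the orthogonal projection onto the range of \<open>V\<^sub>e\<close>.\<close>
  define w' where "w' = hadjoint H (V e) w"
  have w': "w' \<in> carrier H" "\<And>x. x \<in> carrier H \<Longrightarrow> ip H (V e x) w = ip H x w'"
    using hadjoint[OF V_isometry[OF e(1)] w(1)] by (auto simp: w'_def)
  define \<eta> where "\<eta> = w \<ominus>\<^bsub>H\<^esub> V e w'"
  have \<eta>: "\<eta> \<in> carrier H" using w w' e by (simp add: \<eta>_def)
  have \<eta>_nz: "\<eta> \<noteq> \<zero>\<^bsub>H\<^esub>" using w w'(1) e by (auto simp: \<eta>_def diff_eq_0_iff)
  then have n: "hnorm H \<eta> > 0" using hnorm_nonneg[OF \<eta>] hnorm_eq_0_iff[OF \<eta>] by linarith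
  have orth_e: "ip H (V e x) \<eta> = 0" if "x \<in> carrier H" for x
    using that w w' e by (simp add: \<eta>_def ip_diff_right V_ip)
  define \<xi> where "\<xi> = of_real (1 / hnorm H \<eta>) \<odot>\<^bsub>H\<^esub> \<eta>"
  show thesis
  proof
    show "\<xi> \<in> carrier H" using \<eta> by (simp add: \<xi>_def)
    show "hnorm H \<xi> = 1" using \<eta> \<eta>_nz n by (simp add: \<xi>_def hnorm_smult norm_divide)
    fix a x assume a: "a \<in> P" "a \<noteq> 0" and x: "x \<in> carrier H"
    have "V a x = V e (V (a - e) x)" using least[OF a] e x by (simp add: V_V)
    then show "ip H (V a x) \<xi> = 0"
      using orth_e[of "V (a - e) x"] least[OF a] e a x \<eta> by (simp add: \<xi>_def ip_smult_right)
  qed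
qed

end

locale cyclic_wandering = isometric_representation H P V + l2_model j
  for H :: "'a hilbert" and P :: "'g::ab_group_add set" and V
    and j :: "('g \<Rightarrow> complex) \<Rightarrow> 'u" +
  fixes \<xi> :: 'a
  assumes irreducible: "irreducible_rep P (H, V)"
    and \<xi>_mem [simp]: "\<xi> \<in> carrier H" and \<xi>_unit: "hnorm H \<xi> = 1"
    and wandering: "\<And>a x. \<lbrakk>a \<in> P; a \<noteq> 0; x \<in> carrier H\<rbrakk> \<Longrightarrow> ip H (V a x) \<xi> = 0"
begin

text \<open>Because the order is total, either \<open>V\<^sub>b \<xi>\<close> lies in the range of \<open>V\<^sub>a\<close>, where the isometry
  \<open>V\<^sub>a\<close> cancels, or \<open>V\<^sub>a y\<close> is \<open>V\<^sub>b\<close> applied to a vector that is orthogonal to \<open>\<xi>\<close>.\<close>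

lemma ip_V_orbit:
  assumes a: "a \<in> P" and b: "b \<in> P" and y: "y \<in> carrier H"
  shows "ip H (V a y) (V b \<xi>) = (if b - a \<in> P then ip H y (V (b - a) \<xi>) else 0)"
proof (cases "b - a \<in> P")
  case True
  have "V b \<xi> = V a (V (b - a) \<xi>)" using True a by (simp add: V_V)
  then show ?thesis using True a y by (simp add: V_ip)
next
  case False
  then have ab: "a - b \<in> P" "a - b \<noteq> 0" using total by auto
  have "V a y = V b (V (a - b) y)" using ab b y by (simp add: V_V)
  then show ?thesis using False ab b y by (simp add: V_ip wandering)
qed

lemma orbit_orthonormal:
  assumes "b \<in> P" "c \<in> P"
  shows "ip H (V b \<xi>) (V c \<xi>) = (if b = c then 1 else 0)"
proof -
  have "ip H \<xi> \<xi> = 1" using ip_self[OF \<xi>_mem] by (simp add: \<xi>_unit)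
  moreover have "ip H \<xi> (V a \<xi>) = 0" if "a \<in> P" "a \<noteq> 0" for a
    using wandering[OF that \<xi>_mem] ip_commute[of "V a \<xi>" \<xi>] that by simp
  ultimately show ?thesis using assms ip_V_orbit[OF assms \<xi>_mem] by auto
qed

definition coeff :: "'a \<Rightarrow> 'g \<Rightarrow> complex" where
  "coeff y b = (if b \<in> P then ip H y (V b \<xi>) else 0)"

lemma coeff_square_summable:
  assumes y: "y \<in> carrier H"
  shows coeff_mem: "coeff y \<in> ell2 P" and hnorm_coeff_le: "hnorm (l2_space j P) (j (coeff y)) \<le> hnorm H y"
proof -
  have sums: "(\<Sum>b\<in>F. (cmod (coeff y b))\<^sup>2) \<le> (hnorm H y)\<^sup>2" if "finite F" for F
  proof -
    have "(\<Sum>b\<in>F. (cmod (coeff y b))\<^sup>2) = (\<Sum>b\<in>F \<inter> P. (cmod (ip H y (V b \<xi>)))\<^sup>2)"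
      using that by (intro sum.mono_neutral_cong_right) (auto simp: coeff_def)
    also have "\<dots> \<le> (hnorm H y)\<^sup>2"
      by (rule Bessel_inequality[where A = P]) (use that y orbit_orthonormal in auto)
    finally show ?thesis .
  qed
  show "coeff y \<in> ell2 P"
    by (rule ell2_bounded_sums(1)[OF _ sums]) (auto simp: coeff_def)
  moreover have "(\<Sum>\<^sub>\<infinity>b. (cmod (coeff y b))\<^sup>2) \<le> (hnorm H y)\<^sup>2"
    by (rule ell2_bounded_sums(2)[OF _ sums, of P]) (auto simp: coeff_def)
  ultimately show "hnorm (l2_space j P) (j (coeff y)) \<le> hnorm H y"
    using y by (simp add: hnorm_l2 real_le_lsqrt)
qed

lemma coeff_add: "\<lbrakk>x \<in> carrier H; y \<in> carrier H\<rbrakk> \<Longrightarrow> coeff (x \<oplus>\<^bsub>H\<^esub> y) = (\<lambda>b. coeff x b + coeff y b)"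
  by (auto simp: coeff_def ip_add_left)

lemma coeff_diff: "\<lbrakk>x \<in> carrier H; y \<in> carrier H\<rbrakk> \<Longrightarrow> coeff (x \<ominus>\<^bsub>H\<^esub> y) = (\<lambda>b. coeff x b - coeff y b)"
  by (auto simp: coeff_def ip_diff_left)

lemma coeff_smult: "x \<in> carrier H \<Longrightarrow> coeff (c \<odot>\<^bsub>H\<^esub> x) = (\<lambda>b. c * coeff x b)"
  by (auto simp: coeff_def ip_smult_left)

lemma coeff_V: "\<lbrakk>a \<in> P; y \<in> carrier H\<rbrakk> \<Longrightarrow> coeff (V a y) = (\<lambda>b. coeff y (b - a))"
  using add_mem[of _ a] by (force simp: coeff_def ip_V_orbit fun_eq_iff)

lemma coeff_orbit: "b \<in> P \<Longrightarrow> coeff (V b \<xi>) = delta b"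
  by (auto simp: coeff_def orbit_orthonormal delta_def)

text \<open>The kernel is the orthogonal complement of the orbit of \<open>\<xi>\<close>. It is invariant under all \<open>V\<^sub>a\<close> and
  \<open>V\<^sub>a\<^sup>*\<close> and does not contain \<open>\<xi>\<close>, so irreducibility makes it zero.\<close>

lemma coeff_eq_0_imp:
  assumes "y \<in> carrier H" "coeff y = (\<lambda>_. 0)"
  shows "y = \<zero>\<^bsub>H\<^esub>"
proof -
  define M where "M = {y \<in> carrier H. \<forall>v\<in>(\<lambda>b. V b \<xi>) ` P. ip H y v = 0}"
  have M_iff: "y \<in> M \<longleftrightarrow> y \<in> carrier H \<and> coeff y = (\<lambda>_. 0)" for y
    by (auto simp: M_def coeff_def fun_eq_iff)
  have "closed_subspace H M"
    unfolding M_def by (rule annihilator_closed_subspace) auto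
  moreover have "V a ` M \<subseteq> M" if "a \<in> P" for a
    using that by (auto simp: M_iff coeff_V)
  moreover have "hadjoint H (V a) ` M \<subseteq> M" if a: "a \<in> P" for a
  proof clarify
    fix y assume y: "y \<in> M"
    then have yH: "y \<in> carrier H" by (simp add: M_iff)
    note adj = hadjoint[OF V_isometry[OF a] yH]
    have "ip H (hadjoint H (V a) y) (V b \<xi>) = 0" if b: "b \<in> P" for b
    proof -
      have "ip H y (V (a + b) \<xi>) = 0" using y add_mem[OF a b] by (auto simp: M_def)
      then have "ip H (V a (V b \<xi>)) y = 0"
        using a b yH add_mem[OF a b] ip_commute[of y "V (a + b) \<xi>"] by (simp add: V_V)
      then show ?thesis
        using adj(1) adj(2)[of "V b \<xi>"] b ip_commute[of "V b \<xi>" "hadjoint H (V a) y"] by simp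
    qed
    then show "hadjoint H (V a) y \<in> M" using adj(1) by (auto simp: M_def)
  qed
  ultimately have "M = {\<zero>\<^bsub>H\<^esub>} \<or> M = carrier H"
    using irreducible unfolding irreducible_rep_def by blast
  moreover have "\<xi> \<notin> M"
    using coeff_orbit[of 0] by (auto simp: M_iff delta_def fun_eq_iff)
  ultimately show ?thesis using assms M_iff[of y] \<xi>_mem by blast
qed

text \<open>The coefficient map is a contraction, so \<open>y \<mapsto> \<langle>coeff y, f\<rangle>\<close> is a bounded functional, and its
  Riesz vector has coefficients \<open>f\<close>. Pairing that vector with itself shows that it has the norm
  of \<open>f\<close>.\<close>

lemma coeff_onto:
  assumes f: "f \<in> ell2 P"
  obtains z where "z \<in> carrier H" "coeff z = f" "hnorm H z = hnorm (l2_space j P) (j f)"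
proof -
  obtain z where z: "z \<in> carrier H" and rep: "\<And>y. y \<in> carrier H \<Longrightarrow> ell2_ip (coeff y) f = ip H y z"
  proof (rule Riesz_representation[of "\<lambda>y. ell2_ip (coeff y) f" "hnorm (l2_space j P) (j f)"])
    fix x y assume "x \<in> carrier H" "y \<in> carrier H"
    then show "ell2_ip (coeff (x \<oplus>\<^bsub>H\<^esub> y)) f = ell2_ip (coeff x) f + ell2_ip (coeff y) f"
      using l2.ip_add_left[of "j (coeff x)" P "j (coeff y)" "j f"] f coeff_mem
      by (simp add: coeff_add)
  next
    fix c x assume "x \<in> carrier H"
    then show "ell2_ip (coeff (c \<odot>\<^bsub>H\<^esub> x)) f = c * ell2_ip (coeff x) f"
      using l2.ip_smult_left[of "j (coeff x)" P "j f" c] f coeff_mem by (simp add: coeff_smult)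
  next
    fix x assume x: "x \<in> carrier H"
    have "cmod (ell2_ip (coeff x) f) \<le> hnorm (l2_space j P) (j (coeff x)) * hnorm (l2_space j P) (j f)"
      using l2.Cauchy_Schwarz[of "j (coeff x)" P "j f"] f coeff_mem[OF x] by simp
    also have "\<dots> \<le> hnorm H x * hnorm (l2_space j P) (j f)"
      using hnorm_coeff_le[OF x] f by (intro mult_right_mono l2.hnorm_nonneg) auto
    finally show "cmod (ell2_ip (coeff x) f) \<le> hnorm (l2_space j P) (j f) * hnorm H x"
      by (simp add: mult.commute)
  qed blast
  have "coeff z b = f b" for b
  proof (cases "b \<in> P")
    case True
    have "ip H z (V b \<xi>) = cnj (ell2_ip (delta b) f)"
      using rep[of "V b \<xi>"] True z ip_commute[of "V b \<xi>" z] by (simp add: coeff_orbit)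
    also have "\<dots> = ell2_ip f (delta b)"
      using l2.ip_commute[of "j (delta b)" P "j f"] True f by (simp add: delta_ell2)
    finally show ?thesis using True by (simp add: coeff_def ell2_ip_delta)
  next
    case False
    then show ?thesis using f by (simp add: coeff_def ell2_off)
  qed
  then have cz: "coeff z = f" by blast
  from rep[OF z] have "hnorm H z = hnorm (l2_space j P) (j f)"
    by (simp add: hnorm_def cz)
  from z cz this show thesis by (rule that)
qed

lemma equivalent_to_translation:
  "unitarily_equivalent P (H, V) (l2_space j P, translation j)"
proof -
  have norm: "hnorm (l2_space j P) (j (coeff y)) = hnorm H y" if y: "y \<in> carrier H" for y
  proof -
    obtain z where z: "z \<in> carrier H" "coeff z = coeff y" "hnorm H z = hnorm (l2_space j P) (j (coeff y))"
      using coeff_onto[OF coeff_mem[OF y]] by metis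
    then have "y \<ominus>\<^bsub>H\<^esub> z = \<zero>\<^bsub>H\<^esub>"
      using y by (intro coeff_eq_0_imp) (auto simp: coeff_diff)
    then show ?thesis using z y by (simp add: diff_eq_0_iff)
  qed
  have "unitary H (l2_space j P) (\<lambda>y. j (coeff y))"
    unfolding unitary_def isometry_def hlinear_def
  proof (intro conjI)
    show "(\<lambda>y. j (coeff y)) ` carrier H = carrier (l2_space j P)"
    proof
      show "(\<lambda>y. j (coeff y)) ` carrier H \<subseteq> carrier (l2_space j P)"
        using coeff_mem by auto
      show "carrier (l2_space j P) \<subseteq> (\<lambda>y. j (coeff y)) ` carrier H"
      proof
        fix x assume "x \<in> carrier (l2_space j P)"
        then obtain f where f: "f \<in> ell2 P" "x = j f" by auto
        from f(1) obtain z where "z \<in> carrier H" "coeff z = f" by (rule coeff_onto)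
        with f(2) show "x \<in> (\<lambda>y. j (coeff y)) ` carrier H" by blast
      qed
    qed
  qed (auto simp: norm coeff_mem coeff_add coeff_smult)
  moreover have "j (coeff (V a x)) = translation j a (j (coeff x))" if "a \<in> P" "x \<in> carrier H" for a x
    using that by (simp add: translation_def coeff_V)
  ultimately show ?thesis
    unfolding unitarily_equivalent_def prod.case by blast
qed

end

section \<open>Counting equivalence classes\<close>

lemma unitarily_equivalent_refl: "unitarily_equivalent S r r"
proof -
  obtain H V where r: "r = (H, V)" by force
  have "unitary H H id"
    by (auto simp: unitary_def isometry_def hlinear_def)
  then show ?thesis
    unfolding r unitarily_equivalent_def prod.case by (intro exI[of _ id]) auto
qed

text \<open>If \<open>T\<close> and \<open>U\<close> intertwine \<open>r\<close> and \<open>s\<close> with \<open>t\<close>, then \<open>U\<close> inverse after \<open>T\<close> intertwines \<open>r\<close> with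
  \<open>s\<close>. The inverse is chosen pointwise, as \<open>U\<close> is bijective only between the carriers.\<close>

lemma unitarily_equivalent_join:
  assumes r: "isometric_rep S r" and s: "isometric_rep S s" and t: "isometric_rep S t"
    and rt: "unitarily_equivalent S r t" and st: "unitarily_equivalent S s t"
  shows "unitarily_equivalent S r s"
proof -
  obtain H V where r_eq: "r = (H, V)" by force
  obtain K W where s_eq: "s = (K, W)" by force
  obtain L Z where t_eq: "t = (L, Z)" by force
  obtain T where T: "unitary H L T" "\<And>a x. \<lbrakk>a \<in> S; x \<in> carrier H\<rbrakk> \<Longrightarrow> T (V a x) = Z a (T x)"
    using rt unfolding r_eq t_eq unitarily_equivalent_def prod.case by blast
  obtain U where U: "unitary K L U" "\<And>a x. \<lbrakk>a \<in> S; x \<in> carrier K\<rbrakk> \<Longrightarrow> U (W a x) = Z a (U x)"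
    using st unfolding s_eq t_eq unitarily_equivalent_def prod.case by blast
  interpret H: complex_hilbert H using r by (simp add: r_eq isometric_rep_def hilbert_space_iff)
  interpret K: complex_hilbert K using s by (simp add: s_eq isometric_rep_def hilbert_space_iff)
  interpret L: complex_hilbert L using t by (simp add: t_eq isometric_rep_def hilbert_space_iff)
  have T_lin: "\<And>x. x \<in> carrier H \<Longrightarrow> T x \<in> carrier L"
    "\<And>x y. \<lbrakk>x \<in> carrier H; y \<in> carrier H\<rbrakk> \<Longrightarrow> T (x \<oplus>\<^bsub>H\<^esub> y) = T x \<oplus>\<^bsub>L\<^esub> T y"
    "\<And>c x. x \<in> carrier H \<Longrightarrow> T (c \<odot>\<^bsub>H\<^esub> x) = c \<odot>\<^bsub>L\<^esub> T x"
    "\<And>x. x \<in> carrier H \<Longrightarrow> hnorm L (T x) = hnorm H x"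
    using T(1) by (auto simp: unitary_def isometry_def hlinear_def)
  have U_iso: "isometry K L U" using U(1) by (simp add: unitary_def)
  have U_lin: "\<And>x. x \<in> carrier K \<Longrightarrow> U x \<in> carrier L"
    "\<And>x y. \<lbrakk>x \<in> carrier K; y \<in> carrier K\<rbrakk> \<Longrightarrow> U (x \<oplus>\<^bsub>K\<^esub> y) = U x \<oplus>\<^bsub>L\<^esub> U y"
    "\<And>c x. x \<in> carrier K \<Longrightarrow> U (c \<odot>\<^bsub>K\<^esub> x) = c \<odot>\<^bsub>L\<^esub> U x"
    "\<And>x. x \<in> carrier K \<Longrightarrow> hnorm L (U x) = hnorm K x"
    using U_iso by (auto simp: isometry_def hlinear_def)
  have U_inj: "x = y" if "x \<in> carrier K" "y \<in> carrier K" "U x = U y" for x y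
    using isometry_ip[OF K.inner_product_module_axioms L.inner_product_module_axioms U_iso] that
    by (metis K.vector_eqI)
  have "\<forall>x\<in>carrier H. \<exists>y. y \<in> carrier K \<and> U y = T x"
    using T_lin(1) U(1) by (metis (no_types, lifting) imageE unitary_def)
  then obtain Q where Q: "\<And>x. x \<in> carrier H \<Longrightarrow> Q x \<in> carrier K" "\<And>x. x \<in> carrier H \<Longrightarrow> U (Q x) = T x"
    by metis
  have Q_eqI: "Q x = y" if "x \<in> carrier H" "y \<in> carrier K" "U y = T x" for x y
    using that Q U_inj by simp
  have V: "V a x \<in> carrier H" if "a \<in> S" "x \<in> carrier H" for a x
    using r that by (auto simp: r_eq isometric_rep_def isometry_def hlinear_def)
  have W: "W a x \<in> carrier K" if "a \<in> S" "x \<in> carrier K" for a x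
    using s that by (auto simp: s_eq isometric_rep_def isometry_def hlinear_def)
  have "unitary H K Q"
    unfolding unitary_def isometry_def hlinear_def
  proof (intro conjI ballI allI)
    show "Q \<in> carrier H \<rightarrow> carrier K" using Q(1) by blast
    fix x assume x: "x \<in> carrier H"
    show "hnorm K (Q x) = hnorm H x"
      using x Q U_lin(4)[of "Q x"] T_lin(4)[of x] by metis
    show "Q (c \<odot>\<^bsub>H\<^esub> x) = c \<odot>\<^bsub>K\<^esub> Q x" for c
      using x Q U_lin T_lin by (intro Q_eqI) auto
    show "Q (x \<oplus>\<^bsub>H\<^esub> y) = Q x \<oplus>\<^bsub>K\<^esub> Q y" if "y \<in> carrier H" for y
      using x that Q U_lin T_lin by (intro Q_eqI) auto
  next
    show "Q ` carrier H = carrier K"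
    proof
      show "carrier K \<subseteq> Q ` carrier H"
      proof
        fix y assume y: "y \<in> carrier K"
        then have "U y \<in> T ` carrier H" using U_lin(1) T(1) by (simp add: unitary_def)
        then obtain x where x: "x \<in> carrier H" "U y = T x" by blast
        with Q_eqI[OF x(1) y x(2)] show "y \<in> Q ` carrier H" by blast
      qed
    qed (use Q(1) in blast)
  qed
  moreover have "Q (V a x) = W a (Q x)" if "a \<in> S" "x \<in> carrier H" for a x
    using that V W Q T(2) U(2) by (intro Q_eqI) auto
  ultimately show ?thesis
    unfolding r_eq s_eq unitarily_equivalent_def prod.case by blast
qed

lemma (in cone_representations) least_imp_equivalent_to_translation:
  assumes e: "e \<in> P" "e \<noteq> 0" and least: "\<And>a. \<lbrakk>a \<in> P; a \<noteq> 0\<rbrakk> \<Longrightarrow> a - e \<in> P"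
    and r: "r \<in> admissible_reps P"
  shows "unitarily_equivalent P r (l2_space j P, translation j)"
proof -
  obtain H V where r_eq: "r = (H, V)" by force
  from r have rep: "isometric_rep P (H, V)" "irreducible_rep P (H, V)" "nonunitary_rep P (H, V)"
    by (auto simp: admissible_reps_def r_eq)
  then have "complex_hilbert H" by (simp add: isometric_rep_def hilbert_space_iff)
  then interpret isometric_representation H P V
    using rep by (intro isometric_representation.intro isometric_representation_axioms.intro total_cone_axioms)
  obtain \<xi> where "\<xi> \<in> carrier H" "hnorm H \<xi> = 1"
    "\<And>a x. \<lbrakk>a \<in> P; a \<noteq> 0; x \<in> carrier H\<rbrakk> \<Longrightarrow> ip H (V a x) \<xi> = 0"
    using wandering_vector_exists[OF rep(3) e least] by blast
  then interpret cyclic_wandering H P V j \<xi>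
    using rep by unfold_locales auto
  show ?thesis unfolding r_eq by (rule equivalent_to_translation)
qed

lemma sum_const_int_prod: "(\<Sum>i<n. (e :: int \<times> int)) = (int n * fst e, int n * snd e)"
  by (induction n) (auto simp: algebra_simps zero_prod_def plus_prod_def)

text \<open>As long as \<open>b\<close> is not zero, subtracting the least positive element keeps it in the cone. If
  \<open>b\<close> is at most the \<open>n\<close>-fold multiple of that element, zero is reached within \<open>n\<close> steps.\<close>

lemma (in total_cone) multiple_of_least:
  fixes n :: nat
  assumes least: "\<And>a. \<lbrakk>a \<in> P; a \<noteq> 0\<rbrakk> \<Longrightarrow> a - e \<in> P"
  shows "b \<in> P \<Longrightarrow> (\<Sum>i<n. e) - b \<in> P \<Longrightarrow> \<exists>k::nat. b = (\<Sum>i<k. e)"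
proof (induction n arbitrary: b)
  case 0
  then have "b = 0" using uminus_mem_iff[of b] by simp
  then show ?case by (intro exI[of _ 0]) simp
next
  case (Suc n)
  show ?case
  proof (cases "b = 0")
    case True
    then show ?thesis by (intro exI[of _ 0]) simp
  next
    case False
    with least Suc.prems have "b - e \<in> P" by blast
    moreover have "(\<Sum>i<n. e) - (b - e) \<in> P" using Suc.prems(2) by (simp add: algebra_simps)
    ultimately obtain k :: nat where "b - e = (\<Sum>i<k. e)" using Suc.IH by blast
    then have "b = (\<Sum>i<Suc k. e)" by (simp add: algebra_simps)
    then show ?thesis by blast
  qed
qed

text \<open>A positive \<open>a\<close> that is not the sum of two positive elements is the least positive element. In
  an archimedean order it then generates the group, but \<open>\<int> \<times> \<int>\<close> is not cyclic.\<close>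

lemma archimedean_cone_dense:
  fixes P :: "(int \<times> int) set"
  assumes "positive_cone P" and arch: "archimedean_cone P" and a: "a \<in> P - {0}"
  shows "\<exists>b\<in>P - {0}. a - b \<in> P - {0}"
proof (rule ccontr)
  interpret total_cone P by unfold_locales fact
  assume *: "\<not> (\<exists>b\<in>P - {0}. a - b \<in> P - {0})"
  have least: "b - a \<in> P" if "b \<in> P" "b \<noteq> 0" for b
    using * that total[of a b] by auto
  have "\<exists>k::nat. b = (\<Sum>i<k. a)" if b: "b \<in> P" for b
  proof (cases "b = 0")
    case True
    then show ?thesis by (intro exI[of _ 0]) simp
  next
    case False
    then obtain n :: nat where "cone_le P b (\<Sum>i<n. a)"
      using arch a b unfolding archimedean_cone_def by blast
    then show ?thesis
      using multiple_of_least[OF least b] by (auto simp: cone_le_def)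
  qed
  then have mult: "\<exists>k::int. b = (k * fst a, k * snd a)" if "b \<in> P" for b
    using that unfolding sum_const_int_prod by blast
  have "\<exists>k::int. b = (k * fst a, k * snd a)" for b
  proof (cases "b \<in> P")
    case False
    then have "- b \<in> P" using total[of b 0] by simp
    with mult obtain k :: int where "- b = (k * fst a, k * snd a)" by blast
    then have "b = ((- k) * fst a, (- k) * snd a)" by (cases b) (auto simp: uminus_prod_def)
    then show ?thesis by blast
  qed (rule mult)
  then obtain k l where k: "(1, 0) = (k * fst a, k * snd a)" and l: "(0, 1) = (l * fst a, l * snd a)"
    by blast
  from k have "k \<noteq> 0" "k * snd a = 0" by auto
  then have "snd a = 0" by simp
  with l show False by simp
qed

text \<open>Group automorphisms preserve the least positive element, which is \<open>(1, 0)\<close> in the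
  standard lexicographic order.\<close>

lemma lexicographic_cone_least:
  assumes "lexicographic_cone P"
  shows "\<exists>e\<in>P - {0}. \<forall>a\<in>P - {0}. a - e \<in> P"
proof -
  obtain f where f: "Modules.additive f" "bij f" "P = f ` lex_cone"
    using assms unfolding lexicographic_cone_def by blast
  interpret Modules.additive f by (rule f(1))
  have inj: "inj f" using f(2) by (rule bij_is_inj)
  have least: "c - (1, 0) \<in> lex_cone" if "c \<in> lex_cone" "c \<noteq> 0" for c
    using that by (auto simp: lex_cone_def zero_prod_def)
  have "f (1, 0) \<noteq> f 0" using inj by (simp add: inj_eq zero_prod_def)
  then have "f (1, 0) \<in> P - {0}" by (auto simp: f(3) lex_cone_def zero)
  moreover have "a - f (1, 0) \<in> P" if "a \<in> P - {0}" for a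
  proof -
    obtain c where c: "c \<in> lex_cone" "a = f c" using \<open>a \<in> P - {0}\<close> f(3) by blast
    with that have "c \<noteq> 0" using zero by auto
    with least c show ?thesis by (auto simp: f(3) diff[symmetric])
  qed
  ultimately show ?thesis by blast
qed

theorem theorem3p1:
  fixes P :: "(int \<times> int) set"
  assumes cone: "positive_cone P"
    and universe: "\<exists>e :: (nat \<Rightarrow> complex) \<Rightarrow> 'u. inj e"
  shows "(archimedean_cone P \<longrightarrow>
            infinite (Delta TYPE('u) P) \<or> card (Delta TYPE('u) P) > 1) \<and>
         (lexicographic_cone P \<longrightarrow> card (Delta TYPE('u) P) = 1)"
proof -
  obtain e :: "(nat \<Rightarrow> complex) \<Rightarrow> 'u" where e: "inj e" using universe by blast
  define j :: "(int \<times> int \<Rightarrow> complex) \<Rightarrow> 'u" where "j f = e (f \<circ> from_nat)" for f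
  have "inj j"
  proof (rule injI)
    fix f g assume "j f = j g"
    then have "f \<circ> from_nat = g \<circ> from_nat" using e by (simp add: j_def inj_eq)
    then show "f = g" by (metis comp_apply ext from_nat_to_nat)
  qed
  have "P \<noteq> {0}"
  proof
    assume "P = {0}"
    with cone have "UNIV = {0 :: int \<times> int}" by (auto simp: positive_cone_def)
    then have "(1, 0) \<in> {0 :: int \<times> int}" by blast
    then show False by (simp add: zero_prod_def)
  qed
  then interpret cone_representations j P
    using \<open>inj j\<close> cone by unfold_locales
  let ?R = "{(r, s). r \<in> admissible_reps P \<and> s \<in> admissible_reps P \<and> unitarily_equivalent P r s}
    :: ((int \<times> int, 'u) rep \<times> (int \<times> int, 'u) rep) set"
  let ?r = "(l2_space j P, translation j)" and ?s = "(l2_space j (P - {0}), translation j)"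
  have Delta: "Delta TYPE('u) P = (\<lambda>r. ?R `` {r}) ` admissible_reps P"
    by (auto simp: Delta_def quotient_def)
  have "infinite (Delta TYPE('u) P) \<or> card (Delta TYPE('u) P) > 1" if "archimedean_cone P"
  proof -
    have "\<not> unitarily_equivalent P ?r ?s"
      by (rule full_punctured_inequivalent) (rule archimedean_cone_dense[OF cone that])
    then have "?s \<in> ?R `` {?s}" "?s \<notin> ?R `` {?r}"
      using punctured_admissible unitarily_equivalent_refl by auto
    then have "?R `` {?r} \<noteq> ?R `` {?s}" by blast
    then have two: "card {?R `` {?r}, ?R `` {?s}} = 2" by simp
    have sub: "{?R `` {?r}, ?R `` {?s}} \<subseteq> Delta TYPE('u) P"
      unfolding Delta using full_admissible punctured_admissible by blast
    show ?thesis
    proof (cases "finite (Delta TYPE('u) P)")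
      case True
      from card_mono[OF True sub] two show ?thesis by simp
    qed simp
  qed
  moreover have "card (Delta TYPE('u) P) = 1" if "lexicographic_cone P"
  proof -
    obtain e where e: "e \<in> P" "e \<noteq> 0" "\<And>a. \<lbrakk>a \<in> P; a \<noteq> 0\<rbrakk> \<Longrightarrow> a - e \<in> P"
      using lexicographic_cone_least[OF \<open>lexicographic_cone P\<close>] by blast
    have "unitarily_equivalent P r s" if "r \<in> admissible_reps P" "s \<in> admissible_reps P"
      for r s :: "(int \<times> int, 'u) rep"
    proof (rule unitarily_equivalent_join)
      show "isometric_rep P r" "isometric_rep P s" "isometric_rep P ?r"
        using that full_admissible by (simp_all add: admissible_reps_def)
      show "unitarily_equivalent P r ?r" "unitarily_equivalent P s ?r"
        using that by (simp_all add: least_imp_equivalent_to_translation[OF e])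
    qed
    then have "s \<in> ?R `` {r} \<longleftrightarrow> s \<in> admissible_reps P" if "r \<in> admissible_reps P"
      for r s :: "(int \<times> int, 'u) rep"
      unfolding Image_singleton_iff mem_Collect_eq prod.case using that by blast
    then have "?R `` {r} = admissible_reps P" if "r \<in> admissible_reps P" for r
      using that by blast
    then have "Delta TYPE('u) P = {admissible_reps P}"
      unfolding Delta using full_admissible by (intro equalityI subsetI) auto
    then show ?thesis by simp
  qed
  ultimately show ?thesis by blast
qed

end
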